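(* Let $\mathcal{A}$ be a cluster algebra of rank $n$ (trivial coefficients) with a fixed cluster pattern $\mathbf{\Sigma}=\{\Sigma_t=(\mathbf{x}_t,B_t)\}_{t\in\mathbb{T}_n}$ with root vertex $t_0$, and assume its exchange matrices are indecomposable. Suppose $t_\diamond\in\mathbb{T}_n$ is a vertex such that $B_{t_\diamond}\not\sim\pm B_{t_0}$ and $\mathbf{w}_{t_0}(t_0,t_\diamond)=\mathbf{w}_{t_\diamond}(t_0,t_\diamond)=1$. For each vertex $t\in\mathbb{T}_n$ with $B_t\sim\pm B_{t_0}$, fix $\sigma_t\in S_n$ and $\varepsilon_t\in\{\pm\}$ with $\sigma_tB_{t_0}=\varepsilon_tB_t$, and put $f_{p(t_0,t)}:=(\Sigma_{t_0},\Sigma_t,\sigma_t,\varepsilon_t)\in\operatorname{Aut}(\mathcal{A})$. Let $G_0(t_0)$ be the set of cluster automorphisms of the form $(\Sigma_{t_0},\Sigma_{t_0},\sigma,\varepsilon)$ with $\sigma\in S_n$, $\varepsilon\in\{\pm\}$. For $m\ge0$ let $$\mathcal{P}_{1,m}^{t_\diamond}(t_0)=\{p(t_0,t)\mid B_t\sim\pm B_{t_0},\ \mathbf{w}_{t_0}(t_0,t)=2,\ \mathbf{w}_{t_\diamond}(t_0,t)=m\},$$ $$H_{1,m}^{t_\diamond}(t_0)=\{f_{p(t_0,t)}\mid p(t_0,t)\in\mathcal{P}_{1,m}^{t_\diamond}(t_0)\},$$ and let $$K_1^{t_\diamond}(t_0)=\{f_{p(t_0,t)}\mid p(t_0,t)\in\mathcal{P}_{1,2}^{t_\diamond}(t_0)\text{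 and } p(t_0,t)\text{ passes through } t_\diamond\}.$$ Then $\operatorname{Aut}(\mathcal{A})$ is generated by $G_0(t_0)\cup H_{1,0}^{t_\diamond}(t_0)\cup H_{1,1}^{t_\diamond}(t_0)\cup K_1^{t_\diamond}(t_0)$.
   Context: Cluster algebras. Write $[x]_+=\max\{x,0\}$. An $n\times n$ integer matrix $B=(b_{ij})$ is skew-symmetrizable if $DB$ is skew-symmetric for some diagonal matrix $D$ with positive integer diagonal entries. It is indecomposable if the graph on $\{1,\dots,n\}$ with an edge between $i,j$ whenever $b_{ij}\ne0$ is connected. Let $\mathcal{F}$ be a field isomorphic to the field of rational functions over $\mathbb{Q}$ in $n$ variables. A labeled seed is a pair $\Sigma=(\mathbf{x},B)$ with $\mathbf{x}=(x_1,\dots,x_n)$ (the cluster) a free generating set of $\mathcal{F}$ and $B$ skew-symmetrizable (the exchange matrix). The mutation $\mu_k(\Sigma)=(\mathbf{x}',B')$ is given by $b'_{ij}=-b_{ij}$ if $i=k$ or $j=k$, $b'_{ij}=b_{ij}+b_{ik}[b_{kj}]_++[-b_{ik}]_+b_{kj}$ otherwise; $x'_i=x_i$ for $i\ne k$ and $x_k'=x_k^{-1}\big(\prod_j x_j^{[b_{jk}]_+}+\prod_j x_j^{[-b_{jk}]_+}\big)$. $\mathbb{T}_n$ is the $n$-regular tree with edges labeled by $1,\dots,n$, the $n$ edges at each vertex having distinct labels. A cluster pattern is a family $\mathbf{\Sigma}=\{\Sigma_t=(\mathbf{x}_t,B_t)\}_{t\in\mathbb{T}_n}$ of labeled seeds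 such that $\Sigma_{t'}=\mu_k(\Sigma_t)$ whenever $t,t'$ are joined by an edge labeled $k$; $t_0$ is a fixed root vertex. The cluster algebra $\mathcal{A}$ is the $\mathbb{Z}$-subalgebra of $\mathcal{F}$ generated by all cluster variables (entries of all $\mathbf{x}_t$). $S_n$-action. For $\sigma\in S_n$: $(\sigma\mathbf{x})_i=x_{\sigma^{-1}(i)}$ and $(\sigma B)_{ij}=b_{\sigma^{-1}(i)\sigma^{-1}(j)}$. Write $B\sim B'$ if $B'=\sigma B$ for some $\sigma\in S_n$, and $B\sim\pm B'$ if $B\sim B'$ or $B\sim -B'$ (so $B\not\sim\pm B'$ means neither holds). Cluster automorphisms. A $\mathbb{Z}$-algebra automorphism $f:\mathcal{A}\to\mathcal{A}$ is a cluster automorphism if there exist labeled seeds $(\mathbf{x},B),(\mathbf{x}',B')$ in $\mathbf{\Sigma}$ and $\sigma\in S_n$ such that $\sigma f(\mathbf{x})=\mathbf{x}'$ and $\sigma f(\mu_k(\mathbf{x}))=\mu_{\sigma(k)}(\mathbf{x}')$ for all $k$. $\operatorname{Aut}(\mathcal{A})$ is the group of cluster automorphisms under composition. If $\Sigma_1=(\mathbf{x}_1,B_1)$, $\Sigma_2=(\mathbf{x}_2,B_2)$ are seeds of $\mathbf{\Sigma}$ and $\sigma B_1=\varepsilon B_2$ with $\sigma\in S_n$, $\varepsilon\in\{\pm\}$, then $(\Sigma_1,\Sigma_2,\sigma,\varepsilon)$ denotes the unique cluster automorphism $f$ with $\sigma f(\mathbf{x}_1)=\mathbf{x}_2$; writing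 this quadruple presupposes $\sigma B_1=\varepsilon B_2$. Every cluster automorphism can be written as $(\Sigma_{t_0},\Sigma_t,\sigma,\varepsilon)$ for some $t$. Weight. $p(t,t')$ is the unique path in $\mathbb{T}_n$ from $t$ to $t'$. For a vertex $s$, $\mathbf{w}_s(t,t')$ is the number of vertices $t''$ on $p(t,t')$ (endpoints included) with $B_{t''}\sim\pm B_s$. *)

theory Defs
  imports
    "HOL-Analysis.Finite_Cartesian_Product"
    "HOL-Library.Poly_Mapping"
    "HOL-Algebra.Bij"
    "HOL-Algebra.Generated_Groups"
begin

text \<open>
  The rank is n = \<open>CARD('n)\<close>; the finite type \<open>'n\<close> plays the role of the index set of size n,
  and its bijections that of the symmetric group.  The ambient field is the whole type \<open>'f\<close>;
  that it is a field of rational functions over the rationals in n variables is enforced by the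
  existence of a free generating set, which is part of the notion of a labeled seed.
\<close>

subsection \<open>Exchange matrices\<close>

definition pos_part :: "int \<Rightarrow> int" where
  "pos_part x = max x 0"

definition skew_symmetrizable :: "int^'n^'n \<Rightarrow> bool" where
  "skew_symmetrizable B \<longleftrightarrow>
     (\<exists>D :: int^'n^'n. (\<forall>i j. i \<noteq> j \<longrightarrow> D $ i $ j = 0) \<and> (\<forall>i. D $ i $ i > 0) \<and>
        transpose (D ** B) = - (D ** B))"

definition indecomposable :: "int^'n^'n \<Rightarrow> bool" where
  "indecomposable B \<longleftrightarrow> (\<forall>i j. (i, j) \<in> {(i, j). B $ i $ j \<noteq> 0 \<or> B $ j $ i \<noteq> 0}\<^sup>*)"

definition mutate_matrix :: "'n \<Rightarrow> int^'n^'n \<Rightarrow> int^'n^'n" where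
  "mutate_matrix k B =
     (\<chi> i j. if i = k \<or> j = k then - B $ i $ j
             else B $ i $ j + B $ i $ k * pos_part (B $ k $ j)
                            + pos_part (- B $ i $ k) * B $ k $ j)"

text \<open>
  The action of a permutation; \<open>inv_into UNIV \<sigma>\<close> is its inverse (the short form
  would clash with the notation for inverses in a group).
\<close>

definition permute_matrix :: "('n \<Rightarrow> 'n) \<Rightarrow> int^'n^'n \<Rightarrow> int^'n^'n" where
  "permute_matrix \<sigma> B = (\<chi> i j. B $ inv_into UNIV \<sigma> i $ inv_into UNIV \<sigma> j)"

definition matrix_sim :: "int^'n^'n \<Rightarrow> int^'n^'n \<Rightarrow> bool" where
  "matrix_sim B B' \<longleftrightarrow> (\<exists>\<sigma>. bij \<sigma> \<and> B' = permute_matrix \<sigma> B)"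

definition matrix_sim_pm :: "int^'n^'n \<Rightarrow> int^'n^'n \<Rightarrow> bool" where
  "matrix_sim_pm B B' \<longleftrightarrow> matrix_sim B B' \<or> matrix_sim B (- B')"

text \<open>\<open>signed_perm \<sigma> \<epsilon> B\<^sub>1 B\<^sub>2\<close> says \<open>\<sigma> B\<^sub>1 = \<epsilon> B\<^sub>2\<close>, where the sign \<open>\<epsilon>\<close> is one of the integers 1 and -1.\<close>

definition signed_perm :: "('n \<Rightarrow> 'n) \<Rightarrow> int \<Rightarrow> int^'n^'n \<Rightarrow> int^'n^'n \<Rightarrow> bool" where
  "signed_perm \<sigma> \<epsilon> B\<^sub>1 B\<^sub>2 \<longleftrightarrow>
     bij \<sigma> \<and> \<epsilon> \<in> {1, -1} \<and> permute_matrix \<sigma> B\<^sub>1 = map_matrix ((*) \<epsilon>) B\<^sub>2"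

subsection \<open>Labeled seeds and their mutation\<close>

text \<open>
  A polynomial over the rationals in variables indexed by \<open>'n\<close> is a finitely supported map from
  exponent vectors to coefficients.
\<close>

definition poly_eval :: "('n::finite \<Rightarrow> 'f) \<Rightarrow> (('n \<Rightarrow>\<^sub>0 nat) \<Rightarrow>\<^sub>0 rat) \<Rightarrow> 'f::field_char_0" where
  "poly_eval x p =
     (\<Sum>m \<in> Poly_Mapping.keys p. of_rat (Poly_Mapping.lookup p m) *
                                 (\<Prod>i\<in>UNIV. x i ^ Poly_Mapping.lookup m i))"

definition algebraically_independent :: "('n::finite \<Rightarrow> 'f::field_char_0) \<Rightarrow> bool" where
  "algebraically_independent x \<longleftrightarrow> (\<forall>p. poly_eval x p = 0 \<longrightarrow> p = 0)"

definition free_generating_set :: "('n::finite \<Rightarrow> 'f::field_char_0) \<Rightarrow> bool" where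
  "free_generating_set x \<longleftrightarrow> algebraically_independent x \<and>
     (\<forall>y. \<exists>p q. poly_eval x q \<noteq> 0 \<and> y = poly_eval x p / poly_eval x q)"

type_synonym ('n, 'f) seed = "('n \<Rightarrow> 'f) \<times> (int^'n^'n)"

abbreviation cluster :: "('n, 'f) seed \<Rightarrow> 'n \<Rightarrow> 'f" where
  "cluster S \<equiv> fst S"

abbreviation exchange_matrix :: "('n, 'f) seed \<Rightarrow> int^'n^'n" where
  "exchange_matrix S \<equiv> snd S"

definition labeled_seed :: "('n::finite, 'f::field_char_0) seed \<Rightarrow> bool" where
  "labeled_seed S \<longleftrightarrow> free_generating_set (cluster S) \<and> skew_symmetrizable (exchange_matrix S)"

definition mutate_cluster ::
    "'n::finite \<Rightarrow> ('n, 'f::field_char_0) seed \<Rightarrow> 'n \<Rightarrow> 'f" where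
  "mutate_cluster k S =
     (let x = cluster S; B = exchange_matrix S in
      x (k := inverse (x k) *
           ((\<Prod>j\<in>UNIV. x j ^ nat (pos_part (B $ j $ k))) +
            (\<Prod>j\<in>UNIV. x j ^ nat (pos_part (- B $ j $ k))))))"

definition mutate :: "'n::finite \<Rightarrow> ('n, 'f::field_char_0) seed \<Rightarrow> ('n, 'f) seed" where
  "mutate k S = (mutate_cluster k S, mutate_matrix k (exchange_matrix S))"

definition permute_cluster :: "('n \<Rightarrow> 'n) \<Rightarrow> ('n \<Rightarrow> 'f) \<Rightarrow> 'n \<Rightarrow> 'f" where
  "permute_cluster \<sigma> x = (\<lambda>i. x (inv_into UNIV \<sigma> i))"

subsection \<open>The n-regular tree\<close>

text \<open>\<open>E k u v\<close> says that \<open>u\<close> and \<open>v\<close> are joined by an edge labeled \<open>k\<close>; the vertices are all elements of \<open>'t\<close>.\<close>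

definition is_path :: "('n \<Rightarrow> 't \<Rightarrow> 't \<Rightarrow> bool) \<Rightarrow> 't \<Rightarrow> 't \<Rightarrow> 't list \<Rightarrow> bool" where
  "is_path E t t' p \<longleftrightarrow>
     p \<noteq> [] \<and> hd p = t \<and> last p = t' \<and> distinct p \<and> successively (\<lambda>u v. \<exists>k. E k u v) p"

definition regular_labeled_tree :: "('n \<Rightarrow> 't \<Rightarrow> 't \<Rightarrow> bool) \<Rightarrow> bool" where
  "regular_labeled_tree E \<longleftrightarrow>
     (\<forall>k u v. E k u v \<longrightarrow> E k v u \<and> u \<noteq> v) \<and>
     (\<forall>k l u v. E k u v \<and> E l u v \<longrightarrow> k = l) \<and>
     (\<forall>k u. \<exists>!v. E k u v) \<and>
     (\<forall>t t'. \<exists>!p. is_path E t t' p)"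

definition tree_path :: "('n \<Rightarrow> 't \<Rightarrow> 't \<Rightarrow> bool) \<Rightarrow> 't \<Rightarrow> 't \<Rightarrow> 't list" where
  "tree_path E t t' = (THE p. is_path E t t' p)"

subsection \<open>Cluster patterns, cluster algebras and cluster automorphisms\<close>

definition cluster_pattern ::
    "('n::finite \<Rightarrow> 't \<Rightarrow> 't \<Rightarrow> bool) \<Rightarrow> ('t \<Rightarrow> ('n, 'f::field_char_0) seed) \<Rightarrow> bool" where
  "cluster_pattern E S \<longleftrightarrow> regular_labeled_tree E \<and> (\<forall>t. labeled_seed (S t)) \<and>
     (\<forall>k t t'. E k t t' \<longrightarrow> S t' = mutate k (S t))"

inductive_set generated_subring :: "'f::comm_ring_1 set \<Rightarrow> 'f set" for X where
  one: "1 \<in> generated_subring X"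
| incl: "x \<in> X \<Longrightarrow> x \<in> generated_subring X"
| diff: "x \<in> generated_subring X \<Longrightarrow> y \<in> generated_subring X \<Longrightarrow> x - y \<in> generated_subring X"
| mult: "x \<in> generated_subring X \<Longrightarrow> y \<in> generated_subring X \<Longrightarrow> x * y \<in> generated_subring X"

definition cluster_algebra :: "('t \<Rightarrow> ('n::finite, 'f::field_char_0) seed) \<Rightarrow> 'f set" where
  "cluster_algebra S = generated_subring (\<Union>t. range (cluster (S t)))"

text \<open>As in \<^const>\<open>Bij\<close>, maps on a subset of the type are taken to be extensional.\<close>

definition ring_automorphisms :: "'f::comm_ring_1 set \<Rightarrow> ('f \<Rightarrow> 'f) set" where
  "ring_automorphisms A = {f \<in> Bij A. f 1 = 1 \<and>
     (\<forall>a\<in>A. \<forall>b\<in>A. f (a + b) = f a + f b \<and> f (a * b) = f a * f b)}"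

definition cluster_automorphisms ::
    "('t \<Rightarrow> ('n::finite, 'f::field_char_0) seed) \<Rightarrow> ('f \<Rightarrow> 'f) set" where
  "cluster_automorphisms S = {f \<in> ring_automorphisms (cluster_algebra S).
     \<exists>t t' \<sigma>. bij \<sigma> \<and>
       permute_cluster \<sigma> (f \<circ> cluster (S t)) = cluster (S t') \<and>
       (\<forall>k. permute_cluster \<sigma> (f \<circ> mutate_cluster k (S t)) = mutate_cluster (\<sigma> k) (S t'))}"

definition Aut_cluster ::
    "('t \<Rightarrow> ('n::finite, 'f::field_char_0) seed) \<Rightarrow> ('f \<Rightarrow> 'f) monoid" where
  "Aut_cluster S = BijGroup (cluster_algebra S) \<lparr>carrier := cluster_automorphisms S\<rparr>"

text \<open>
  The quadruple \<open>(S t\<^sub>1, S t\<^sub>2, \<sigma>, \<epsilon>)\<close>, meaningful only if \<open>\<sigma> B\<^sub>1 = \<epsilon> B\<^sub>2\<close> for the two exchange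
  matrices, that is, if \<^const>\<open>signed_perm\<close> holds.  The automorphism is determined by the two
  clusters and \<open>\<sigma>\<close> alone, so \<open>\<epsilon>\<close> does not occur on the right-hand side.
\<close>

definition quad_automorphism ::
    "('t \<Rightarrow> ('n::finite, 'f::field_char_0) seed) \<Rightarrow> 't \<Rightarrow> 't \<Rightarrow> ('n \<Rightarrow> 'n) \<Rightarrow> int \<Rightarrow> 'f \<Rightarrow> 'f" where
  "quad_automorphism S t\<^sub>1 t\<^sub>2 \<sigma> \<epsilon> =
     (THE f. f \<in> cluster_automorphisms S \<and>
        permute_cluster \<sigma> (f \<circ> cluster (S t\<^sub>1)) = cluster (S t\<^sub>2))"

subsection \<open>Weights and the generating sets\<close>

definition weight ::
    "('n::finite \<Rightarrow> 't \<Rightarrow> 't \<Rightarrow> bool) \<Rightarrow> ('t \<Rightarrow> ('n, 'f::field_char_0) seed) \<Rightarrow> 't \<Rightarrow> 't \<Rightarrow> 't \<Rightarrow> nat" where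
  "weight E S s t t' =
     card {v \<in> set (tree_path E t t'). matrix_sim_pm (exchange_matrix (S v)) (exchange_matrix (S s))}"

definition G0 ::
    "('t \<Rightarrow> ('n::finite, 'f::field_char_0) seed) \<Rightarrow> 't \<Rightarrow> ('f \<Rightarrow> 'f) set" where
  "G0 S t\<^sub>0 = {quad_automorphism S t\<^sub>0 t\<^sub>0 \<sigma> \<epsilon> | \<sigma> \<epsilon>.
     signed_perm \<sigma> \<epsilon> (exchange_matrix (S t\<^sub>0)) (exchange_matrix (S t\<^sub>0))}"

definition P1 ::
    "('n::finite \<Rightarrow> 't \<Rightarrow> 't \<Rightarrow> bool) \<Rightarrow> ('t \<Rightarrow> ('n, 'f::field_char_0) seed) \<Rightarrow> 't \<Rightarrow> 't \<Rightarrow> nat \<Rightarrow> 't list set" where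
  "P1 E S t\<^sub>d t\<^sub>0 m = {tree_path E t\<^sub>0 t | t.
     matrix_sim_pm (exchange_matrix (S t)) (exchange_matrix (S t\<^sub>0)) \<and>
     weight E S t\<^sub>0 t\<^sub>0 t = 2 \<and> weight E S t\<^sub>d t\<^sub>0 t = m}"

text \<open>
  The automorphism \<open>f t\<close> attached to the path from \<open>t\<^sub>0\<close> to \<open>t\<close> depends on the chosen
  permutation \<open>\<sigma> t\<close> and sign \<open>\<epsilon> t\<close>; \<open>H1\<close> and \<open>K1\<close> take the resulting family \<open>f\<close> as a parameter.
\<close>

definition path_automorphism ::
    "('t \<Rightarrow> ('n::finite, 'f::field_char_0) seed) \<Rightarrow> 't \<Rightarrow> ('t \<Rightarrow> 'n \<Rightarrow> 'n) \<Rightarrow> ('t \<Rightarrow> int) \<Rightarrow> 't \<Rightarrow> 'f \<Rightarrow> 'f" where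
  "path_automorphism S t\<^sub>0 \<sigma> \<epsilon> t = quad_automorphism S t\<^sub>0 t (\<sigma> t) (\<epsilon> t)"

definition H1 ::
    "('n::finite \<Rightarrow> 't \<Rightarrow> 't \<Rightarrow> bool) \<Rightarrow> ('t \<Rightarrow> ('n, 'f::field_char_0) seed) \<Rightarrow> ('t \<Rightarrow> 'f \<Rightarrow> 'f) \<Rightarrow>
     't \<Rightarrow> 't \<Rightarrow> nat \<Rightarrow> ('f \<Rightarrow> 'f) set" where
  "H1 E S f t\<^sub>d t\<^sub>0 m = {f t | t. tree_path E t\<^sub>0 t \<in> P1 E S t\<^sub>d t\<^sub>0 m}"

definition K1 ::
    "('n::finite \<Rightarrow> 't \<Rightarrow> 't \<Rightarrow> bool) \<Rightarrow> ('t \<Rightarrow> ('n, 'f::field_char_0) seed) \<Rightarrow> ('t \<Rightarrow> 'f \<Rightarrow> 'f) \<Rightarrow>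
     't \<Rightarrow> 't \<Rightarrow> ('f \<Rightarrow> 'f) set" where
  "K1 E S f t\<^sub>d t\<^sub>0 = {f t | t. tree_path E t\<^sub>0 t \<in> P1 E S t\<^sub>d t\<^sub>0 2 \<and> t\<^sub>d \<in> set (tree_path E t\<^sub>0 t)}"

end

theory Submission
  imports Defs
begin

text \<open>
  A signed permutation matching the exchange matrices at two vertices induces a field automorphism
  permuting the clusters, together with an automorphism of the tree; conversely, algebraic
  independence makes a cluster automorphism match the columns of the exchange matrices up to signs,
  which agree because the matrices are indecomposable.  Hence \<open>B\<^sub>t \<sim> \<plusminus>B\<^sub>s\<close> means that \<open>t\<close> and \<open>s\<close>
  lie in one orbit, and it suffices to move \<open>t\<^sub>0\<close> to every vertex of its orbit.  Follow the path to
  such a vertex, and at each copy of \<open>t\<^sub>d\<close> make a detour along a copy of the path from \<open>t\<^sub>d\<close>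
  to \<open>t\<^sub>0\<close>.  Consecutive copies of \<open>t\<^sub>0\<close> met on the way are joined by translates of paths from \<open>t\<^sub>0\<close>
  containing no copies of \<open>t\<^sub>0\<close> besides their endpoints and at most two copies of \<open>t\<^sub>d\<close>, one of them
  \<open>t\<^sub>d\<close> itself if there are two.
\<close>

subsection \<open>Evaluation of polynomials\<close>

definition monom_eval :: "('n::finite \<Rightarrow> 'f) \<Rightarrow> ('n \<Rightarrow>\<^sub>0 nat) \<Rightarrow> 'f::field_char_0" where
  "monom_eval x m = (\<Prod>i\<in>UNIV. x i ^ Poly_Mapping.lookup m i)"

lemma monom_eval_0 [simp]: "monom_eval x 0 = 1"
  by (simp add: monom_eval_def)

lemma monom_eval_add: "monom_eval x (m + m') = monom_eval x m * monom_eval x m'"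
  by (simp add: monom_eval_def lookup_add power_add prod.distrib)

text \<open>A common finite index set lets the sums belonging to different polynomials be
  combined.\<close>

lemma poly_eval_superset:
  assumes "finite M" "Poly_Mapping.keys p \<subseteq> M"
  shows "poly_eval x p = (\<Sum>m\<in>M. of_rat (Poly_Mapping.lookup p m) * monom_eval x m)"
  unfolding poly_eval_def monom_eval_def[symmetric]
  by (rule sum.mono_neutral_left) (use assms in \<open>auto simp: in_keys_iff\<close>)

lemma poly_eval_add: "poly_eval x (p + q) = poly_eval x p + poly_eval x q"
proof -
  let ?M = "Poly_Mapping.keys p \<union> Poly_Mapping.keys q"
  have "Poly_Mapping.keys (p + q) \<subseteq> ?M"
    by (rule keys_add)
  then show ?thesis
    by (simp add: poly_eval_superset[of ?M] lookup_add of_rat_add distrib_right sum.distrib)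
qed

lemma poly_eval_single:
  "poly_eval x (Poly_Mapping.single m c) = of_rat c * monom_eval x m"
  by (simp add: poly_eval_superset[of "{m}"])

lemma poly_eval_0 [simp]: "poly_eval x 0 = 0"
  by (simp add: poly_eval_def)

lemma poly_eval_1 [simp]: "poly_eval x 1 = 1"
  unfolding single_one[symmetric] by (simp only: poly_eval_single) simp

lemma poly_eval_uminus: "poly_eval x (- p) = - poly_eval x p"
  using poly_eval_add[of x "- p" p] by (simp add: eq_neg_iff_add_eq_0)

lemma poly_eval_diff: "poly_eval x (p - q) = poly_eval x p - poly_eval x q"
  using poly_eval_add[of x p "- q"] by (simp add: poly_eval_uminus)

lemma poly_eval_sum: "poly_eval x (\<Sum>a\<in>A. f a) = (\<Sum>a\<in>A. poly_eval x (f a))"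
  by (induction A rule: infinite_finite_induct) (auto simp: poly_eval_add)

lemma poly_mapping_sum_singles:
  "p = (\<Sum>m\<in>Poly_Mapping.keys p. Poly_Mapping.single m (Poly_Mapping.lookup p m))"
  by (rule poly_mapping_eqI)
     (auto simp: lookup_sum lookup_single when_def sum.delta in_keys_iff)

text \<open>Both factors are expanded into single terms, on which evaluation is
  multiplicative.\<close>

lemma poly_eval_mult: "poly_eval x (p * q) = poly_eval x p * poly_eval x q"
proof -
  have "p * q = (\<Sum>m\<in>Poly_Mapping.keys p. \<Sum>m'\<in>Poly_Mapping.keys q.
           Poly_Mapping.single (m + m') (Poly_Mapping.lookup p m * Poly_Mapping.lookup q m'))"
    by (subst poly_mapping_sum_singles[of p], subst poly_mapping_sum_singles[of q])
       (simp add: sum_product mult_single)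
  then have "poly_eval x (p * q) = (\<Sum>m\<in>Poly_Mapping.keys p. \<Sum>m'\<in>Poly_Mapping.keys q.
      (of_rat (Poly_Mapping.lookup p m) * monom_eval x m) *
      (of_rat (Poly_Mapping.lookup q m') * monom_eval x m'))"
    by (simp add: poly_eval_sum poly_eval_single of_rat_mult monom_eval_add mult_ac)
  then show ?thesis
    by (simp add: poly_eval_def monom_eval_def sum_product)
qed

lemma poly_eval_variable:
  "poly_eval x (Poly_Mapping.single (Poly_Mapping.single i 1) 1) = x i"
proof -
  have "monom_eval x (Poly_Mapping.single i 1) = x i ^ 1"
    unfolding monom_eval_def
    by (subst prod.mono_neutral_cong_right[of UNIV "{i}" _ "\<lambda>j. x j ^ 1"])
       (auto simp: lookup_single_not_eq)
  then show ?thesis by (simp add: poly_eval_single)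
qed

section \<open>Field homomorphisms and their extension from a free generating set\<close>

definition field_hom :: "('a::field \<Rightarrow> 'b::field) \<Rightarrow> bool" where
  "field_hom \<phi> \<longleftrightarrow> \<phi> 1 = 1 \<and> (\<forall>a b. \<phi> (a + b) = \<phi> a + \<phi> b \<and> \<phi> (a * b) = \<phi> a * \<phi> b)"

lemma field_homD:
  assumes "field_hom \<phi>"
  shows "\<phi> 1 = 1" "\<phi> (a + b) = \<phi> a + \<phi> b" "\<phi> (a * b) = \<phi> a * \<phi> b" "\<phi> 0 = 0"
    "\<phi> (- a) = - \<phi> a" "\<phi> (a - b) = \<phi> a - \<phi> b" "\<phi> (inverse a) = inverse (\<phi> a)"
    "\<phi> (a ^ m) = \<phi> a ^ m" "\<phi> (\<Prod>i\<in>I. h i) = (\<Prod>i\<in>I. \<phi> (h i))"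
    "inj \<phi>"
proof -
  show one: "\<phi> 1 = 1" and add: "\<phi> (a + b) = \<phi> a + \<phi> b" and mult: "\<phi> (a * b) = \<phi> a * \<phi> b"
    for a b using assms by (auto simp: field_hom_def)
  show zero: "\<phi> 0 = 0" by (metis add add_0 add_cancel_right_right)
  show neg: "\<phi> (- a) = - \<phi> a" for a
    using add[of "-a" a] zero by (simp add: eq_neg_iff_add_eq_0)
  show diff: "\<phi> (a - b) = \<phi> a - \<phi> b" for a b using add[of a "-b"] neg by simp
  have inverse_nz: "\<phi> (inverse a) * \<phi> a = 1" if "a \<noteq> 0" for a
    using mult[of "inverse a" a] that one by simp
  show "\<phi> (inverse a) = inverse (\<phi> a)"
  proof (cases "a = 0")
    case True then show ?thesis by (simp add: zero)
  next
    case False then show ?thesis using inverse_nz[of a] by (metis inverse_unique mult.commute)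
  qed
  show "\<phi> (a ^ m) = \<phi> a ^ m" by (induction m) (auto simp: one mult)
  show "\<phi> (\<Prod>i\<in>I. h i) = (\<Prod>i\<in>I. \<phi> (h i))"
    by (induction I rule: infinite_finite_induct) (auto simp: one mult)
  show "inj \<phi>"
  proof (rule injI)
    fix a b assume "\<phi> a = \<phi> b"
    then have "\<phi> (a - b) = 0" by (simp add: diff)
    then show "a = b" using inverse_nz[of "a - b"] by auto
  qed
qed

text \<open>The quotients p(x)/q(x) exhaust the field. Independence of \<open>x\<close> makes
  p(y)/q(y) depend only on the value of the quotient, and independence of \<open>y\<close> keeps the
  denominators nonzero.\<close>

lemma field_hom_extending:
  fixes x :: "'n::finite \<Rightarrow> 'f::field_char_0" and y :: "'n \<Rightarrow> 'g::field_char_0"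
  assumes x: "free_generating_set x" and y: "algebraically_independent y"
  obtains \<phi> where "field_hom \<phi>" "\<And>i. \<phi> (x i) = y i"
proof -
  define R where "R z w \<longleftrightarrow>
    (\<exists>p q. poly_eval x q \<noteq> 0 \<and> z = poly_eval x p / poly_eval x q \<and> w = poly_eval y p / poly_eval y q)"
    for z w
  have x_indep: "p = 0" if "poly_eval x p = 0" for p
    using x that by (auto simp: free_generating_set_def algebraically_independent_def)
  have y_nz: "poly_eval y q \<noteq> 0" if "poly_eval x q \<noteq> 0" for q
    using y that by (auto simp: algebraically_independent_def)
  have R_unique: "w = w'" if R: "R z w" "R z w'" for z w w'
  proof -
    obtain p q where pq: "poly_eval x q \<noteq> 0" "z = poly_eval x p / poly_eval x q"
      "w = poly_eval y p / poly_eval y q" using R(1) by (auto simp: R_def)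
    obtain p' q' where pq': "poly_eval x q' \<noteq> 0" "z = poly_eval x p' / poly_eval x q'"
      "w' = poly_eval y p' / poly_eval y q'" using R(2) by (auto simp: R_def)
    \<comment> \<open>The cross-multiplied difference vanishes at \<open>x\<close>, so it is the
      zero polynomial and vanishes at \<open>y\<close> as well.\<close>
    have "poly_eval x (p * q' - p' * q) = 0"
      using pq pq' by (simp add: poly_eval_diff poly_eval_mult field_simps)
    then have "p * q' - p' * q = 0" by (rule x_indep)
    then have "poly_eval y (p * q' - p' * q) = 0" by simp
    then show ?thesis
      using pq(3) pq'(3) y_nz[OF pq(1)] y_nz[OF pq'(1)]
      by (simp add: poly_eval_diff poly_eval_mult frac_eq_eq)
  qed
  define \<phi> where "\<phi> z = (THE w. R z w)" for z
  have \<phi>_eq: "\<phi> z = w" if "R z w" for z w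
    unfolding \<phi>_def using that R_unique by blast
  have ex_R: "\<exists>w. R z w" for z
    using x by (fastforce simp: free_generating_set_def R_def)
  have R_\<phi>: "R z (\<phi> z)" for z
    using ex_R[of z] \<phi>_eq by metis
  have R_add: "R (z + z') (w + w')" and R_mult: "R (z * z') (w * w')"
    if R: "R z w" "R z' w'" for z z' w w'
  proof -
    obtain p q where pq: "poly_eval x q \<noteq> 0" "z = poly_eval x p / poly_eval x q"
      "w = poly_eval y p / poly_eval y q" using R(1) by (auto simp: R_def)
    obtain p' q' where pq': "poly_eval x q' \<noteq> 0" "z' = poly_eval x p' / poly_eval x q'"
      "w' = poly_eval y p' / poly_eval y q'" using R(2) by (auto simp: R_def)
    show "R (z + z') (w + w')" unfolding R_def
      by (rule exI[of _ "p * q' + p' * q"], rule exI[of _ "q * q'"])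
         (use pq pq' y_nz in \<open>simp add: poly_eval_add poly_eval_mult field_simps\<close>)
    show "R (z * z') (w * w')" unfolding R_def
      by (rule exI[of _ "p * p'"], rule exI[of _ "q * q'"])
         (use pq pq' y_nz in \<open>simp add: poly_eval_mult\<close>)
  qed
  have R_poly: "R (poly_eval x p) (poly_eval y p)" for p
    unfolding R_def by (rule exI[of _ p], rule exI[of _ 1]) simp
  have "\<phi> 1 = 1" using \<phi>_eq[OF R_poly[of 1]] by simp
  then have "field_hom \<phi>"
    unfolding field_hom_def using \<phi>_eq[OF R_add[OF R_\<phi> R_\<phi>]] \<phi>_eq[OF R_mult[OF R_\<phi> R_\<phi>]] by blast
  moreover have "\<phi> (x i) = y i" for i
    using \<phi>_eq[OF R_poly[of "Poly_Mapping.single (Poly_Mapping.single i 1) 1"]]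
    by (simp only: poly_eval_variable)
  ultimately show ?thesis by (rule that)
qed

section \<open>Consequences of algebraic independence\<close>

lemma algebraically_independent_nonzero:
  assumes "algebraically_independent x" shows "x i \<noteq> 0"
proof
  assume "x i = 0"
  then have "Poly_Mapping.single (Poly_Mapping.single i (1::nat)) (1::rat) = 0"
    using assms unfolding algebraically_independent_def by (metis poly_eval_variable)
  then show False
    by (metis lookup_single_eq lookup_zero zero_neq_one)
qed

text \<open>All coefficients are positive, so nothing cancels and comparing coefficients at the four
  exponents suffices; a repeated exponent shows up as a coefficient 2.\<close>

lemma poly_mapping_single_add_eq:
  assumes "Poly_Mapping.single a 1 + Poly_Mapping.single b (1::rat) =
           Poly_Mapping.single c 1 + Poly_Mapping.single d 1"
  shows "a = c \<and> b = d \<or> a = d \<and> b = c"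
proof -
  have *: "(1 when a = m) + (1 when b = m) = (1 when c = m) + ((1::rat) when d = m)" for m
    using arg_cong[OF assms, of "\<lambda>p. Poly_Mapping.lookup p m"]
    by (simp add: lookup_add lookup_single)
  show ?thesis
    using *[of a] *[of b] *[of c] *[of d] by (auto simp: when_def split: if_splits)
qed

text \<open>Independence turns the equality of values into one of polynomials. This is how an
  exchange relation reveals a column of the exchange matrix up to sign.\<close>

lemma monom_eval_sum_eq:
  fixes x :: "'n::finite \<Rightarrow> 'f::field_char_0"
  assumes x: "algebraically_independent x"
    and eq: "(\<Prod>i\<in>UNIV. x i ^ a i) + (\<Prod>i\<in>UNIV. x i ^ b i) =
             (\<Prod>i\<in>UNIV. x i ^ c i) + (\<Prod>i\<in>UNIV. x i ^ d i)"
  shows "a = c \<and> b = d \<or> a = d \<and> b = c"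
proof -
  define m where "m e = Abs_poly_mapping e" for e :: "'n \<Rightarrow> nat"
  have lookup_m: "Poly_Mapping.lookup (m e) = e" for e
    unfolding m_def by (rule lookup_Abs_poly_mapping) simp
  define p where "p = Poly_Mapping.single (m a) (1::rat) + Poly_Mapping.single (m b) 1
                   - (Poly_Mapping.single (m c) 1 + Poly_Mapping.single (m d) 1)"
  have "poly_eval x p = 0"
    using eq by (simp add: p_def poly_eval_diff poly_eval_add poly_eval_single monom_eval_def lookup_m)
  then have "p = 0" using x by (simp add: algebraically_independent_def)
  then have "m a = m c \<and> m b = m d \<or> m a = m d \<and> m b = m c"
    by (intro poly_mapping_single_add_eq) (simp add: p_def)
  then show ?thesis by (metis lookup_m)
qed

lemma map_key_inv_bij:
  assumes "bij \<sigma>"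
  shows "Poly_Mapping.map_key (inv_into UNIV \<sigma>) (Poly_Mapping.map_key \<sigma> m) = m"
    and "Poly_Mapping.map_key \<sigma> (Poly_Mapping.map_key (inv_into UNIV \<sigma>) m) = m"
  using assms
  by (auto intro!: poly_mapping_eqI
      simp: map_key.rep_eq bij_is_inj bij_is_surj surj_f_inv_f bij_imp_bij_inv)

text \<open>Renaming variables is a bijection on polynomials, so a relation among the renamed
  variables pulls back to one among the original ones.\<close>

lemma algebraically_independent_reindex:
  fixes x :: "'n::finite \<Rightarrow> 'f::field_char_0" and \<sigma> :: "'n \<Rightarrow> 'n"
  assumes x: "algebraically_independent x" and \<sigma>: "bij \<sigma>"
  shows "algebraically_independent (\<lambda>i. x (\<sigma> i))"
  unfolding algebraically_independent_def
proof (intro allI impI)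
  fix p assume p: "poly_eval (\<lambda>i. x (\<sigma> i)) p = 0"
  \<comment> \<open>\<open>q\<close> is \<open>p\<close> with its variables renamed so that its
    value at \<open>x\<close> is that of \<open>p\<close> at the reindexed family.\<close>
  define q where "q = Poly_Mapping.map_key (Poly_Mapping.map_key \<sigma>) p"
  have "inj (Poly_Mapping.map_key \<sigma> :: ('n \<Rightarrow>\<^sub>0 nat) \<Rightarrow> _)"
    by (metis map_key_inv_bij(1)[OF \<sigma>] injI)
  then have lookup_q: "Poly_Mapping.lookup q m = Poly_Mapping.lookup p (Poly_Mapping.map_key \<sigma> m)" for m
    by (simp add: q_def map_key.rep_eq)
  have "poly_eval x q = poly_eval (\<lambda>i. x (\<sigma> i)) p"
    unfolding poly_eval_def monom_eval_def[symmetric]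
  proof (rule sum.reindex_bij_witness[where i = "Poly_Mapping.map_key (inv_into UNIV \<sigma>)"
          and j = "Poly_Mapping.map_key \<sigma>"])
    show "of_rat (Poly_Mapping.lookup p (Poly_Mapping.map_key \<sigma> m)) *
        monom_eval (\<lambda>i. x (\<sigma> i)) (Poly_Mapping.map_key \<sigma> m) =
        of_rat (Poly_Mapping.lookup q m) * monom_eval x m" for m
      using prod.reindex_bij_betw[OF \<sigma>, of "\<lambda>i. x i ^ Poly_Mapping.lookup m i"] \<sigma>
      by (simp add: monom_eval_def lookup_q map_key.rep_eq bij_is_inj)
  qed (auto simp: map_key_inv_bij[OF \<sigma>] in_keys_iff lookup_q)
  then have "q = 0"
    using p x by (simp add: algebraically_independent_def)
  then show "p = 0"
    by (intro poly_mapping_eqI) (metis lookup_q map_key_inv_bij(2)[OF \<sigma>] lookup_zero)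
qed

subsection \<open>Paths and automorphisms of the regular tree\<close>

locale labeled_tree =
  fixes E :: "'n \<Rightarrow> 't \<Rightarrow> 't \<Rightarrow> bool"
  assumes regular: "regular_labeled_tree E"
begin

abbreviation adj :: "'t \<Rightarrow> 't \<Rightarrow> bool" where
  "adj \<equiv> \<lambda>u v. \<exists>k. E k u v"

definition neighbour :: "'n \<Rightarrow> 't \<Rightarrow> 't" where
  "neighbour k u = (THE v. E k u v)"

definition edge_label :: "'t \<Rightarrow> 't \<Rightarrow> 'n" where
  "edge_label u v = (THE k. E k u v)"

lemma edge_sym: "E k u v \<Longrightarrow> E k v u"
  and edge_label_unique: "E k u v \<Longrightarrow> E l u v \<Longrightarrow> k = l"
  and edge_ex1: "\<exists>!v. E k u v"
  and path_ex1: "\<exists>!p. is_path E u v p"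
  using regular unfolding regular_labeled_tree_def by blast+

lemma edge_neq: "E k u v \<Longrightarrow> u \<noteq> v"
  using regular unfolding regular_labeled_tree_def by blast

lemma edge_neighbour: "E k u (neighbour k u)"
  unfolding neighbour_def using edge_ex1 by (rule theI')

lemma edge_label_eq: "E k u v \<Longrightarrow> edge_label u v = k"
  unfolding edge_label_def using edge_label_unique by blast

lemma is_path_tree_path: "is_path E u v (tree_path E u v)"
  unfolding tree_path_def using path_ex1 by (rule theI')

lemma tree_path_eq: "is_path E u v p \<Longrightarrow> tree_path E u v = p"
  using path_ex1 is_path_tree_path by blast

lemma tree_path_props:
  shows tree_path_nonempty: "tree_path E u v \<noteq> []"
    and hd_tree_path: "hd (tree_path E u v) = u"
    and last_tree_path: "last (tree_path E u v) = v"
    and distinct_tree_path: "distinct (tree_path E u v)"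
    and successively_tree_path: "successively adj (tree_path E u v)"
  using is_path_tree_path[of u v] by (auto simp: is_path_def)

lemma endpoints_in_tree_path: "u \<in> set (tree_path E u v)" "v \<in> set (tree_path E u v)"
  using tree_path_nonempty hd_tree_path last_tree_path hd_in_set last_in_set by metis+

lemma tree_path_refl [simp]: "tree_path E u u = [u]"
  by (rule tree_path_eq) (simp add: is_path_def)

lemma tree_path_edge: "E k u v \<Longrightarrow> tree_path E u v = [u, v]"
  by (rule tree_path_eq) (auto simp: is_path_def dest: edge_neq)

text \<open>Prepend the first vertex to a path extracted from the remaining walk; if it already
  occurs there, cut off the loop it closes.\<close>

lemma walk_contains_path:
  assumes "p \<noteq> []" "successively adj p"
  shows "\<exists>q. is_path E (hd p) (last p) q \<and> set q \<subseteq> set p"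
  using assms
proof (induction p)
  case Nil then show ?case by simp
next
  case (Cons a p)
  show ?case
  proof (cases "p = []")
    case True
    then show ?thesis by (intro exI[of _ "[a]"]) (simp add: is_path_def)
  next
    case False
    then obtain q where q: "is_path E (hd p) (last p) q" "set q \<subseteq> set p"
      using Cons by (auto simp: successively_Cons)
    have adj: "adj a (hd q)"
      using Cons.prems False q by (auto simp: successively_Cons is_path_def)
    show ?thesis
    proof (cases "a \<in> set q")
      case True
      then obtain q1 q2 where "q = q1 @ a # q2" by (meson split_list)
      with q False show ?thesis
        by (intro exI[of _ "a # q2"])
           (auto simp: is_path_def successively_append_iff split: if_splits)
    next
      case False': False
      with q False adj show ?thesis
        by (intro exI[of _ "a # q"]) (auto simp: is_path_def successively_Cons)
    qed
  qed
qed

lemma tree_path_subset_walk: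
  assumes "p \<noteq> []" "successively adj p"
  shows "set (tree_path E (hd p) (last p)) \<subseteq> set p"
  using walk_contains_path[OF assms] tree_path_eq by blast

text \<open>The two paths joined at \<open>b\<close> form a walk, and a walk covers the tree path
  between its ends. This inclusion stands in for an analysis of where the three paths
  branch.\<close>

lemma tree_path_subset_Un:
  "set (tree_path E a c) \<subseteq> set (tree_path E a b) \<union> set (tree_path E b c)"
proof -
  obtain q where q: "tree_path E b c = b # q"
    using tree_path_nonempty hd_tree_path by (metis list.collapse)
  let ?p = "tree_path E a b @ q"
  have "successively adj ?p"
    using successively_tree_path[of a b] successively_tree_path[of b c] last_tree_path[of a b]
    by (auto simp: q successively_append_iff successively_Cons)
  moreover have "last ?p = c"
    using last_tree_path[of a b] last_tree_path[of b c] by (auto simp: q split: if_splits)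
  moreover have "hd ?p = a" "?p \<noteq> []"
    using hd_tree_path[of a b] tree_path_nonempty[of a b] by auto
  ultimately show ?thesis
    using tree_path_subset_walk[of ?p] by (auto simp: q)
qed

lemma tree_path_commute: "tree_path E v u = rev (tree_path E u v)"
proof (rule tree_path_eq)
  have "successively (\<lambda>x y. adj y x) (tree_path E u v)"
    by (rule successively_mono[OF successively_tree_path]) (blast dest: edge_sym)
  then show "is_path E v u (rev (tree_path E u v))"
    using tree_path_props[of u v] by (simp add: is_path_def hd_rev last_rev)
qed

lemma tree_path_map:
  assumes "inj \<tau>" "\<And>u v. adj u v \<Longrightarrow> adj (\<tau> u) (\<tau> v)"
  shows "tree_path E (\<tau> u) (\<tau> v) = map \<tau> (tree_path E u v)"
proof (rule tree_path_eq)
  have "successively (\<lambda>a b. adj (\<tau> a) (\<tau> b)) (tree_path E u v)"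
    by (rule successively_mono[OF successively_tree_path]) (rule assms(2))
  moreover have "distinct (map \<tau> (tree_path E u v))"
    using distinct_tree_path inj_on_subset[OF assms(1) subset_UNIV] by (simp add: distinct_map)
  ultimately show "is_path E (\<tau> u) (\<tau> v) (map \<tau> (tree_path E u v))"
    using tree_path_props[of u v] by (simp add: is_path_def hd_map last_map successively_map)
qed

lemma tree_path_extend:
  assumes "E k u v" "v \<notin> set (tree_path E t u)"
  shows "tree_path E t v = tree_path E t u @ [v]"
  using assms tree_path_props[of t u]
  by (intro tree_path_eq) (auto simp: is_path_def successively_append_iff)

text \<open>If \<open>v\<close> lies on the path to \<open>u\<close>, the initial segment ending at
  \<open>v\<close> is the path to \<open>v\<close> and misses \<open>u\<close>, so appending
  \<open>u\<close> gives the path to \<open>u\<close>; otherwise \<open>v\<close> itself can be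
  appended.\<close>

lemma tree_path_step:
  assumes "E k u v"
  shows "tree_path E t v = tree_path E t u @ [v] \<or> tree_path E t u = tree_path E t v @ [u]"
proof (cases "v \<in> set (tree_path E t u)")
  case True
  have "set (tree_path E t v) \<subseteq> set (tree_path E t u) - {u}"
  proof -
    obtain p q where pq: "tree_path E t u = p @ v # q"
      using True by (meson split_list)
    have "is_path E t v (p @ [v])"
      using tree_path_props[of t u] unfolding pq
      by (auto simp: is_path_def successively_append_iff hd_append split: if_splits)
    then have path_v: "tree_path E t v = p @ [v]" by (rule tree_path_eq)
    have "u \<in> set q"
      using last_tree_path[of t u] edge_neq[OF assms] unfolding pq
      by (auto split: if_splits)
    then show ?thesis
      using distinct_tree_path[of t u] unfolding path_v pq by auto
  qed
  then show ?thesis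
    using tree_path_extend[OF edge_sym[OF assms], of t] by blast
next
  case False
  then show ?thesis using tree_path_extend[OF assms] by blast
qed

section \<open>Induction over the tree and maps acting on edge labels\<close>

lemma tree_induct [case_names root step]:
  assumes "P t" and "\<And>k u v. P u \<Longrightarrow> E k u v \<Longrightarrow> P v"
  shows "P s"
proof -
  have "P (last p)" if "successively adj p" "p \<noteq> []" "P (hd p)" for p
    using that by (induction p) (auto simp: successively_Cons intro: assms(2))
  from this[OF successively_tree_path tree_path_nonempty] show ?thesis
    by (metis hd_tree_path last_tree_path assms(1))
qed

text \<open>A label at a vertex determines the neighbour, so agreement at one vertex spreads along
  edges.\<close>

lemma label_preserving_unique:
  assumes "\<And>k u v. E k u v \<Longrightarrow> E (\<sigma> k) (\<tau> u) (\<tau> v)" "\<And>k u v. E k u v \<Longrightarrow> E (\<sigma> k) (\<tau>' u) (\<tau>' v)"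
    and "\<tau> t = \<tau>' t"
  shows "\<tau> s = \<tau>' s"
proof (induction s rule: tree_induct[of _ t])
  case (step k u v)
  then show ?case using assms(1,2)[OF step(2)] edge_ex1 by metis
qed (rule assms(3))

text \<open>The argument list is a path read from its far end back to its start.\<close>

fun transport :: "('n \<Rightarrow> 'n) \<Rightarrow> 't \<Rightarrow> 't list \<Rightarrow> 't" where
  "transport \<sigma> t (u # v # p) = neighbour (\<sigma> (edge_label u v)) (transport \<sigma> t (v # p))"
| "transport \<sigma> t p = t"

text \<open>Follow from \<open>t'\<close> the labels of the path leaving \<open>t\<close>, each
  passed through \<sigma>. The paths to adjacent vertices differ by one edge, so edges are
  respected.\<close>

lemma ex_relabeling:
  "\<exists>\<tau>. \<tau> t = t' \<and> (\<forall>k u v. E k u v \<longrightarrow> E (\<sigma> k) (\<tau> u) (\<tau> v))"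
proof (intro exI[of _ "\<lambda>u. transport \<sigma> t' (rev (tree_path E t u))"] conjI allI impI)
  have extend: "E (\<sigma> k) (transport \<sigma> t' (rev (tree_path E t u)))
                      (transport \<sigma> t' (rev (tree_path E t v)))"
    if "E k u v" "tree_path E t v = tree_path E t u @ [v]" for k u v
  proof -
    \<comment> \<open>Reversed, the path to \<open>v\<close> begins with \<open>v\<close> and
      \<open>u\<close>, so the recursive equation of \<open>transport\<close> strips exactly the new
      edge.\<close>
    obtain p where "rev (tree_path E t u) = u # p"
      using tree_path_nonempty last_tree_path by (metis hd_rev list.collapse rev_is_Nil_conv)
    then show ?thesis
      using that edge_label_eq[OF edge_sym[OF that(1)]] by (simp add: edge_neighbour)
  qed
  show "E (\<sigma> k) (transport \<sigma> t' (rev (tree_path E t u))) (transport \<sigma> t' (rev (tree_path E t v)))"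
    if "E k u v" for k u v
    using tree_path_step[OF that, of t] extend that edge_sym by blast
qed simp

text \<open>Relabelings along \<sigma> and along its inverse compose to label-preserving maps fixing
  a vertex, and such maps are the identity.\<close>

lemma ex_tree_automorphism:
  assumes "bij \<sigma>"
  obtains \<tau> where "bij \<tau>" "\<tau> t = t'" "\<And>k u v. E k u v \<Longrightarrow> E (\<sigma> k) (\<tau> u) (\<tau> v)"
proof -
  obtain \<tau> where \<tau>: "\<tau> t = t'" "\<And>k u v. E k u v \<Longrightarrow> E (\<sigma> k) (\<tau> u) (\<tau> v)"
    using ex_relabeling by blast
  obtain \<tau>' where \<tau>': "\<tau>' t' = t" "\<And>k u v. E k u v \<Longrightarrow> E (inv_into UNIV \<sigma> k) (\<tau>' u) (\<tau>' v)"
    using ex_relabeling by blast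
  have "(\<tau>' \<circ> \<tau>) u = id u" for u
  proof (rule label_preserving_unique[of id _ id t])
    show "E (id k) ((\<tau>' \<circ> \<tau>) u) ((\<tau>' \<circ> \<tau>) v)" if "E k u v" for k u v
      using \<tau>'(2)[OF \<tau>(2)[OF that]] assms by (simp add: bij_is_inj)
  qed (simp_all add: \<tau>(1) \<tau>'(1))
  then have 1: "\<tau>' \<circ> \<tau> = id" by blast
  have "(\<tau> \<circ> \<tau>') u = id u" for u
  proof (rule label_preserving_unique[of id _ id t'])
    show "E (id k) ((\<tau> \<circ> \<tau>') u) ((\<tau> \<circ> \<tau>') v)" if "E k u v" for k u v
      using \<tau>(2)[OF \<tau>'(2)[OF that]] assms by (simp add: bij_is_surj surj_f_inv_f)
  qed (simp_all add: \<tau>(1) \<tau>'(1))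
  then have 2: "\<tau> \<circ> \<tau>' = id" by blast
  show ?thesis
    using that[OF o_bij[OF 1 2] \<tau>] by blast
qed

end

subsection \<open>Mutation and signed relabelings\<close>

text \<open>The second factor of the mutation formula as a function of one column \<open>b\<close>,
  so that changes of sign and of indexing can be treated apart from mutation.\<close>

definition exchange_binomial :: "('n::finite \<Rightarrow> 'f::comm_semiring_1) \<Rightarrow> ('n \<Rightarrow> int) \<Rightarrow> 'f" where
  "exchange_binomial x b =
     (\<Prod>j\<in>UNIV. x j ^ nat (pos_part (b j))) + (\<Prod>j\<in>UNIV. x j ^ nat (pos_part (- b j)))"

lemma mutate_cluster_eq:
  "mutate_cluster k T =
     (cluster T)(k := inverse (cluster T k) *
        exchange_binomial (cluster T) (\<lambda>j. exchange_matrix T $ j $ k))"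
  by (simp add: mutate_cluster_def exchange_binomial_def Let_def)

lemma exchange_binomial_sign:
  assumes "\<epsilon> \<in> {1, -1::int}"
  shows "exchange_binomial x (\<lambda>j. \<epsilon> * b j) = exchange_binomial x b"
  using assms by (auto simp: exchange_binomial_def add.commute)

lemma exchange_binomial_reindex:
  assumes "bij \<sigma>"
  shows "exchange_binomial (\<lambda>j. x (\<sigma> j)) (\<lambda>j. b (\<sigma> j)) = exchange_binomial x b"
  using prod.reindex_bij_betw[OF assms, of "\<lambda>j. x j ^ nat (pos_part (b j))"]
    prod.reindex_bij_betw[OF assms, of "\<lambda>j. x j ^ nat (pos_part (- b j))"]
  by (simp add: exchange_binomial_def)

text \<open>The positive and negative parts determine a column; matching them in the other order
  negates it.\<close>

lemma exchange_binomial_inject: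
  assumes "algebraically_independent x" "exchange_binomial x b = exchange_binomial x c"
  shows "\<exists>\<epsilon>\<in>{1, -1}. \<forall>j. b j = \<epsilon> * c j"
proof -
  from monom_eval_sum_eq[OF assms(1) assms(2)[unfolded exchange_binomial_def]]
  show ?thesis
  proof (elim disjE conjE)
    assume eq: "(\<lambda>j. nat (pos_part (b j))) = (\<lambda>j. nat (pos_part (c j)))"
      "(\<lambda>j. nat (pos_part (- b j))) = (\<lambda>j. nat (pos_part (- c j)))"
    have "b j = 1 * c j" for j
      using fun_cong[OF eq(1), of j] fun_cong[OF eq(2), of j]
      by (auto simp: pos_part_def max_def split: if_splits)
    then show ?thesis by blast
  next
    assume eq: "(\<lambda>j. nat (pos_part (b j))) = (\<lambda>j. nat (pos_part (- c j)))"
      "(\<lambda>j. nat (pos_part (- b j))) = (\<lambda>j. nat (pos_part (c j)))"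
    have "b j = - 1 * c j" for j
      using fun_cong[OF eq(1), of j] fun_cong[OF eq(2), of j]
      by (auto simp: pos_part_def max_def split: if_splits)
    then show ?thesis by blast
  qed
qed

section \<open>Signed relabelings of matrices and seeds\<close>

lemma signed_perm_iff:
  "signed_perm \<sigma> \<epsilon> B\<^sub>1 B\<^sub>2 \<longleftrightarrow>
     bij \<sigma> \<and> \<epsilon> \<in> {1, -1} \<and> (\<forall>i j. B\<^sub>2 $ \<sigma> i $ \<sigma> j = \<epsilon> * B\<^sub>1 $ i $ j)"
proof (cases "bij \<sigma> \<and> \<epsilon> \<in> {1, -1}")
  case True
  then have \<sigma>: "inv_into UNIV \<sigma> (\<sigma> i) = i" "\<sigma> (inv_into UNIV \<sigma> i) = i" for i
    by (simp_all add: bij_is_inj bij_is_surj surj_f_inv_f)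
  have sign: "a = \<epsilon> * b" if "b = \<epsilon> * a" for a b
    using True that by auto
  have "signed_perm \<sigma> \<epsilon> B\<^sub>1 B\<^sub>2 \<longleftrightarrow>
      (\<forall>i j. B\<^sub>1 $ inv_into UNIV \<sigma> i $ inv_into UNIV \<sigma> j = \<epsilon> * B\<^sub>2 $ i $ j)"
    using True by (auto simp: signed_perm_def permute_matrix_def vec_eq_iff map_matrix_def)
  also have "\<dots> \<longleftrightarrow> (\<forall>i j. B\<^sub>1 $ i $ j = \<epsilon> * B\<^sub>2 $ \<sigma> i $ \<sigma> j)"
    by (metis \<sigma>)
  also have "\<dots> \<longleftrightarrow> (\<forall>i j. B\<^sub>2 $ \<sigma> i $ \<sigma> j = \<epsilon> * B\<^sub>1 $ i $ j)"
    using sign by blast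
  finally show ?thesis using True by blast
qed (auto simp: signed_perm_def)

lemma matrix_sim_pm_iff_signed_perm:
  fixes B\<^sub>1 B\<^sub>2 :: "int^'n::finite^'n"
  shows "matrix_sim_pm B\<^sub>1 B\<^sub>2 \<longleftrightarrow> (\<exists>\<sigma> \<epsilon>. signed_perm \<sigma> \<epsilon> B\<^sub>1 B\<^sub>2)"
proof -
  have "map_matrix ((*) 1) B\<^sub>2 = B\<^sub>2" "map_matrix ((*) (- 1)) B\<^sub>2 = - B\<^sub>2"
    by (simp_all add: vec_eq_iff map_matrix_def)
  then show ?thesis
    by (auto simp: matrix_sim_pm_def matrix_sim_def signed_perm_def)
       (metis minus_minus)+
qed

lemma permute_cluster_eq_iff:
  assumes "bij \<sigma>"
  shows "permute_cluster \<sigma> x = y \<longleftrightarrow> (\<forall>j. x j = y (\<sigma> j))"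
  using assms unfolding permute_cluster_def fun_eq_iff
  by (metis bij_inv_eq_iff)

text \<open>Mutation is natural in the indices and commutes with negating the matrix.\<close>

lemma mutate_matrix_signed:
  assumes "signed_perm \<sigma> \<epsilon> B B'"
  shows "signed_perm \<sigma> \<epsilon> (mutate_matrix k B) (mutate_matrix (\<sigma> k) B')"
proof -
  have \<sigma>: "bij \<sigma>" "\<epsilon> \<in> {1, -1}" and B': "B' $ \<sigma> i $ \<sigma> j = \<epsilon> * B $ i $ j" for i j
    using assms by (auto simp: signed_perm_iff)
  have eq: "\<sigma> i = \<sigma> j \<longleftrightarrow> i = j" for i j
    using \<sigma> by (simp add: bij_is_inj inj_eq)
  \<comment> \<open>The case of sign -1: substitute [-b]_+ = [b]_+ - b and [a]_+ = a +
    [-a]_+.\<close>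
  have sign_flip: "- a * pos_part (- b) + pos_part a * - b = - (a * pos_part b + pos_part (- a) * b)" for a b
    by (auto simp: pos_part_def max_def algebra_simps)
  have "\<epsilon> * a * pos_part (\<epsilon> * b) + pos_part (- (\<epsilon> * a)) * (\<epsilon> * b) =
      \<epsilon> * (a * pos_part b + pos_part (- a) * b)" for a b
    using \<sigma>(2) sign_flip by auto
  from this[of "B $ i $ k" "B $ k $ j" for i j] show ?thesis
    using \<sigma> by (auto simp: signed_perm_iff mutate_matrix_def B' eq distrib_left add.assoc)
qed

text \<open>The matched columns agree up to sign after reindexing, and the exchange binomial is
  invariant under both changes.\<close>

lemma mutate_cluster_field_hom:
  assumes "field_hom \<phi>" "signed_perm \<sigma> \<epsilon> (exchange_matrix T) (exchange_matrix T')"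
    and "\<And>j. \<phi> (cluster T j) = cluster T' (\<sigma> j)"
  shows "\<phi> (mutate_cluster k T j) = mutate_cluster (\<sigma> k) T' (\<sigma> j)"
proof -
  have \<sigma>: "bij \<sigma>" "\<epsilon> \<in> {1, -1}"
    and B': "exchange_matrix T' $ \<sigma> i $ \<sigma> j = \<epsilon> * exchange_matrix T $ i $ j" for i j
    using assms(2) by (auto simp: signed_perm_iff)
  have "\<phi> (exchange_binomial (cluster T) b) = exchange_binomial (\<lambda>j. cluster T' (\<sigma> j)) b" for b
    by (simp add: exchange_binomial_def field_homD[OF assms(1)] assms(3))
  also have "exchange_binomial (\<lambda>j. cluster T' (\<sigma> j)) (\<lambda>j. exchange_matrix T $ j $ k) =
      exchange_binomial (\<lambda>j. cluster T' (\<sigma> j)) (\<lambda>j. exchange_matrix T' $ \<sigma> j $ \<sigma> k)"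
    by (simp only: B' exchange_binomial_sign[OF \<sigma>(2)])
  also have "\<dots> = exchange_binomial (cluster T') (\<lambda>j. exchange_matrix T' $ j $ \<sigma> k)"
    by (rule exchange_binomial_reindex[OF \<sigma>(1)])
  finally show ?thesis
    using \<sigma>(1)
    by (simp add: mutate_cluster_eq field_homD[OF assms(1)] assms(3) bij_is_inj inj_eq)
qed

text \<open>Entrywise the condition reads d_i b_ij = - d_j b_ji with positive d_i and d_j.\<close>

lemma skew_symmetrizable_sgn:
  assumes "skew_symmetrizable B" shows "sgn (B $ i $ j) = - sgn (B $ j $ i)"
proof -
  obtain D :: "int^'a^'a" where D: "\<And>i j. i \<noteq> j \<Longrightarrow> D $ i $ j = 0" "\<And>i. D $ i $ i > 0"
    "transpose (D ** B) = - (D ** B)"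
    using assms by (auto simp: skew_symmetrizable_def)
  have DB: "(D ** B) $ i $ j = D $ i $ i * B $ i $ j" for i j
  proof -
    have "(D ** B) $ i $ j = (\<Sum>k\<in>{i}. D $ i $ k * B $ k $ j)"
      unfolding matrix_matrix_mult_def using D(1)
      by (simp, intro sum.mono_neutral_cong_right[of UNIV "{i}", simplified]) auto
    then show ?thesis by simp
  qed
  have "(D ** B) $ i $ j = - ((D ** B) $ j $ i)"
    using arg_cong[OF D(3), of "\<lambda>M. M $ j $ i"] by (simp add: transpose_def)
  then have "sgn (D $ i $ i * B $ i $ j) = - sgn (D $ j $ j * B $ j $ i)"
    unfolding DB by (simp add: sgn_minus)
  then show ?thesis using D(2)[of i] D(2)[of j] by (simp add: sgn_mult)
qed

text \<open>
  A skew-symmetrizable matrix satisfies \<open>b\<^sub>i\<^sub>j > 0 \<longleftrightarrow> b\<^sub>j\<^sub>i < 0\<close>, so the signs of two columns \<open>i\<close>, \<open>j\<close> with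
  \<open>b\<^sub>i\<^sub>j \<noteq> 0\<close> have to agree; connectedness propagates this to all columns.
\<close>

lemma uniform_column_sign:
  fixes B B' :: "int^'n::finite^'n"
  assumes "skew_symmetrizable B" "skew_symmetrizable B'" "indecomposable B"
    and "bij \<sigma>"
    and columns: "\<And>k. \<exists>\<epsilon>\<in>{1, -1}. \<forall>j. B' $ \<sigma> j $ \<sigma> k = \<epsilon> * B $ j $ k"
  shows "\<exists>\<epsilon>. signed_perm \<sigma> \<epsilon> B B'"
proof -
  obtain e where e: "\<And>k. e k \<in> {1, -1}" "\<And>j k. B' $ \<sigma> j $ \<sigma> k = e k * B $ j $ k"
    using columns by metis
  have adjacent: "e i = e k" if "B $ i $ k \<noteq> 0 \<or> B $ k $ i \<noteq> 0" for i k
  proof -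
    have "sgn (e k * B $ i $ k) = - sgn (e i * B $ k $ i)"
      using skew_symmetrizable_sgn[OF assms(2), of "\<sigma> i" "\<sigma> k"] by (simp add: e(2))
    moreover have "sgn (B $ i $ k) = - sgn (B $ k $ i)"
      by (rule skew_symmetrizable_sgn[OF assms(1)])
    ultimately show ?thesis
      using that e(1)[of i] e(1)[of k] by (auto simp: sgn_if split: if_splits)
  qed
  have "e i = e k" for i k
  proof -
    have "(i, k) \<in> {(i, j). B $ i $ j \<noteq> 0 \<or> B $ j $ i \<noteq> 0}\<^sup>*"
      using assms(3) by (simp add: indecomposable_def)
    then show ?thesis
    proof (induction rule: rtrancl_induct)
      case (step j k)
      then show ?case using adjacent[of j k] by auto
    qed simp
  qed
  \<comment> \<open>All column signs coincide, so the sign of an arbitrary column serves.\<close>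
  then have "signed_perm \<sigma> (e undefined) B B'"
    using e assms(4) by (metis signed_perm_iff)
  then show ?thesis ..
qed

subsection \<open>Ring automorphisms of generated subrings\<close>

lemma generated_subring_zero: "0 \<in> generated_subring X"
  using generated_subring.diff[OF generated_subring.one generated_subring.one] by simp

lemma generated_subring_uminus: "a \<in> generated_subring X \<Longrightarrow> - a \<in> generated_subring X"
  using generated_subring.diff[OF generated_subring_zero] by fastforce

lemma generated_subring_add:
  "a \<in> generated_subring X \<Longrightarrow> b \<in> generated_subring X \<Longrightarrow> a + b \<in> generated_subring X"
  using generated_subring.diff[of a X "- b"] generated_subring_uminus[of b] by simp

lemma generated_subring_power: "a \<in> generated_subring X \<Longrightarrow> a ^ m \<in> generated_subring X"
  by (induction m) (auto intro: generated_subring.intros)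

lemma generated_subring_prod:
  "(\<And>i. i \<in> I \<Longrightarrow> h i \<in> generated_subring X) \<Longrightarrow> (\<Prod>i\<in>I. h i) \<in> generated_subring X"
  by (induction I rule: infinite_finite_induct) (auto intro: generated_subring.intros)

lemmas generated_subring_closed =
  generated_subring.intros generated_subring_zero generated_subring_add
  generated_subring_power generated_subring_prod

text \<open>Meant for a homomorphism permuting the cluster variables: it maps the cluster algebra
  onto itself.\<close>

lemma field_hom_image_generated_subring:
  assumes "field_hom \<phi>" shows "\<phi> ` generated_subring X = generated_subring (\<phi> ` X)"
proof (intro equalityI subsetI)
  fix b assume "b \<in> \<phi> ` generated_subring X"
  then obtain a where "a \<in> generated_subring X" "b = \<phi> a" by blast
  then show "b \<in> generated_subring (\<phi> ` X)"
    by (induction a arbitrary: b)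
       (auto simp: field_homD[OF assms] intro: generated_subring.intros)
next
  fix b assume "b \<in> generated_subring (\<phi> ` X)"
  then show "b \<in> \<phi> ` generated_subring X"
  proof induction
    case one
    then show ?case using field_homD(1)[OF assms] generated_subring.one by (metis image_eqI)
  next
    case (diff a b)
    then show ?case using field_homD(6)[OF assms, symmetric] by (auto intro: generated_subring.diff)
  next
    case (mult a b)
    then show ?case using field_homD(3)[OF assms, symmetric] by (auto intro: generated_subring.mult)
  qed (auto intro: generated_subring.incl)
qed

text \<open>The ring laws for \<open>f\<close> are given only inside the subring, so each sum, power
  and product has to be seen to stay there.\<close>

lemma ring_automorphism_exchange_binomial:
  assumes f: "f \<in> ring_automorphisms (generated_subring X)" and x: "\<And>j. x j \<in> generated_subring X"
  shows "f (exchange_binomial x b) = exchange_binomial (\<lambda>j. f (x j)) b"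
proof -
  let ?A = "generated_subring X"
  have hom: "f 1 = 1" "\<And>a b. a \<in> ?A \<Longrightarrow> b \<in> ?A \<Longrightarrow> f (a + b) = f a + f b"
    "\<And>a b. a \<in> ?A \<Longrightarrow> b \<in> ?A \<Longrightarrow> f (a * b) = f a * f b"
    using f by (auto simp: ring_automorphisms_def)
  have power: "f (a ^ m) = f a ^ m" if "a \<in> ?A" for a m
    using that by (induction m) (auto simp: hom generated_subring_closed)
  have prod: "f (\<Prod>i\<in>I. h i) = (\<Prod>i\<in>I. f (h i))" if "\<And>i. h i \<in> ?A" for I and h :: "'b \<Rightarrow> 'a"
    using that by (induction I rule: infinite_finite_induct) (auto simp: hom generated_subring_closed)
  show ?thesis
    by (simp add: exchange_binomial_def hom prod power x generated_subring_closed)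
qed

text \<open>Injectivity on the subring; it allows images of cluster variables to be cancelled in
  exchange relations.\<close>

lemma ring_automorphism_zero_iff:
  assumes f: "f \<in> ring_automorphisms (generated_subring X)" and "a \<in> generated_subring X"
  shows "f a = 0 \<longleftrightarrow> a = 0"
proof -
  have "f (0 + 0) = f 0 + f 0"
    using f generated_subring_zero[of X] unfolding ring_automorphisms_def by blast
  then have "f 0 = 0" by (metis add_0 add_cancel_right_right)
  moreover have "inj_on f (generated_subring X)"
    using f by (auto simp: ring_automorphisms_def Bij_def bij_betw_def)
  ultimately show ?thesis
    using assms(2) generated_subring_zero by (metis inj_onD)
qed

text \<open>Agreement spreads over the inductive generation of the subring, and extensionality
  settles the values outside it.\<close>

lemma ring_automorphisms_eqI:
  assumes f: "f \<in> ring_automorphisms (generated_subring X)"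
    and g: "g \<in> ring_automorphisms (generated_subring X)"
    and eq: "\<And>a. a \<in> X \<Longrightarrow> f a = g a"
  shows "f = g"
proof (rule extensionalityI)
  let ?A = "generated_subring X"
  show "f \<in> extensional ?A" "g \<in> extensional ?A"
    using f g by (auto simp: ring_automorphisms_def Bij_def)
  have diff: "h (a - b) = h a - h b" if "h \<in> ring_automorphisms ?A" "a \<in> ?A" "b \<in> ?A" for h a b
  proof -
    have "h ((a - b) + b) = h (a - b) + h b"
      using that generated_subring.diff[of a X b] unfolding ring_automorphisms_def by blast
    then show ?thesis by simp
  qed
  fix a assume "a \<in> ?A"
  then show "f a = g a"
  proof induction
    case one
    then show ?case using f g by (simp add: ring_automorphisms_def)
  next
    case (mult a b)
    then show ?case using f g by (simp add: ring_automorphisms_def)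
  qed (simp_all add: eq diff[OF f] diff[OF g])
qed

subsection \<open>The symmetries of a cluster pattern\<close>

locale indecomposable_pattern =
  fixes E :: "'n::finite \<Rightarrow> 't \<Rightarrow> 't \<Rightarrow> bool"
    and S :: "'t \<Rightarrow> ('n, 'f::field_char_0) seed"
  assumes pattern: "cluster_pattern E S"
    and indecomposable: "\<And>t. indecomposable (exchange_matrix (S t))"
begin

sublocale labeled_tree E
  using pattern by unfold_locales (simp add: cluster_pattern_def)

abbreviation x :: "'t \<Rightarrow> 'n \<Rightarrow> 'f" where "x t \<equiv> cluster (S t)"
abbreviation B :: "'t \<Rightarrow> int^'n^'n" where "B t \<equiv> exchange_matrix (S t)"
abbreviation A :: "'f set" where "A \<equiv> cluster_algebra S"

lemma free_generating: "free_generating_set (x t)"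
  and skew: "skew_symmetrizable (B t)"
  and seed_mutate: "E k u v \<Longrightarrow> S v = mutate k (S u)"
  using pattern by (auto simp: cluster_pattern_def labeled_seed_def)

lemma independent: "algebraically_independent (x t)"
  using free_generating by (simp add: free_generating_set_def)

lemma cluster_mutate: "E k u v \<Longrightarrow> x v = mutate_cluster k (S u)"
  by (simp add: seed_mutate mutate_def)

lemma cluster_nonzero: "x t j \<noteq> 0"
  using algebraically_independent_nonzero[OF independent] .

lemma cluster_in_algebra: "x t j \<in> A"
  unfolding cluster_algebra_def by (rule generated_subring.incl) blast

text \<open>Mutation without division: both sides are built inside the cluster algebra, so an
  automorphism of that ring can be applied.\<close>

lemma exchange_relation:
  assumes "E k u v" shows "x u k * x v k = exchange_binomial (x u) (\<lambda>j. B u $ j $ k)"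
  using cluster_nonzero[of u k] by (simp add: cluster_mutate[OF assms] mutate_cluster_eq)

lemma cluster_unchanged: "E k u v \<Longrightarrow> j \<noteq> k \<Longrightarrow> x v j = x u j"
  by (simp add: cluster_mutate mutate_cluster_eq)

lemma automorphism_exchange_relation:
  assumes f: "f \<in> ring_automorphisms A" and "E k u v"
  shows "f (x u k) * f (x v k) = exchange_binomial (\<lambda>j. f (x u j)) (\<lambda>j. B u $ j $ k)"
proof -
  have "f (x u k * x v k) = f (x u k) * f (x v k)"
    using f cluster_in_algebra by (auto simp: ring_automorphisms_def)
  then show ?thesis
    using ring_automorphism_exchange_binomial[of f "\<Union>t. range (x t)" "x u"] f cluster_in_algebra
    by (simp add: exchange_relation[OF assms(2)] cluster_algebra_def)
qed

lemma automorphism_nonzero: "f \<in> ring_automorphisms A \<Longrightarrow> f (x t j) \<noteq> 0"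
  using ring_automorphism_zero_iff cluster_in_algebra cluster_nonzero
  unfolding cluster_algebra_def by blast

text \<open>Across an edge the exchange relation determines the image of the new variable, since the
  image of the replaced one is nonzero. By connectedness one cluster determines the images of all
  cluster variables.\<close>

lemma automorphism_determined:
  assumes f: "f \<in> ring_automorphisms A" and g: "g \<in> ring_automorphisms A"
    and eq: "\<And>j. f (x t j) = g (x t j)"
  shows "f = g"
proof -
  have "\<forall>j. f (x s j) = g (x s j)" for s
  proof (induction s rule: tree_induct[of _ t])
    case (step k u v)
    have "f (x u k) * f (x v k) = g (x u k) * g (x v k)"
      using automorphism_exchange_relation[OF f step(2)]
        automorphism_exchange_relation[OF g step(2)] step(1) by simp
    then have "f (x v k) = g (x v k)"
      using step automorphism_nonzero[OF f, of u k] by simp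
    then show ?case using step cluster_unchanged by metis
  qed (simp add: eq)
  then show ?thesis
    using f g unfolding cluster_algebra_def by (intro ring_automorphisms_eqI) auto
qed

text \<open>
  Tracking the induced automorphism \<open>\<tau>\<close> of the tree together with \<open>f\<close> makes composition and
  inversion transparent; \<open>\<tau>\<close> need not be determined by \<open>f\<close>, as seeds may recur in the tree.
\<close>

definition relabels :: "('f \<Rightarrow> 'f) \<Rightarrow> ('t \<Rightarrow> 't) \<Rightarrow> ('n \<Rightarrow> 'n) \<Rightarrow> int \<Rightarrow> bool" where
  "relabels f \<tau> \<sigma> \<epsilon> \<longleftrightarrow> f \<in> ring_automorphisms A \<and> bij \<tau> \<and>
     (\<forall>k u v. E k u v \<longrightarrow> E (\<sigma> k) (\<tau> u) (\<tau> v)) \<and>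
     (\<forall>s. signed_perm \<sigma> \<epsilon> (B s) (B (\<tau> s))) \<and> (\<forall>s j. f (x s j) = x (\<tau> s) (\<sigma> j))"

definition symmetry :: "('f \<Rightarrow> 'f) \<Rightarrow> ('t \<Rightarrow> 't) \<Rightarrow> bool" where
  "symmetry f \<tau> \<longleftrightarrow> (\<exists>\<sigma> \<epsilon>. relabels f \<tau> \<sigma> \<epsilon>)"

text \<open>The relabeling of one cluster extends to the field, and that of the labels to the tree.
  Mutation commutes with signed relabelings, so the two extensions stay matched at every
  vertex.\<close>

lemma ex_relabels:
  assumes "signed_perm \<sigma> \<epsilon> (B t) (B t')"
  obtains f \<tau> where "relabels f \<tau> \<sigma> \<epsilon>" "\<tau> t = t'"
proof -
  have \<sigma>: "bij \<sigma>" using assms by (simp add: signed_perm_def)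
  obtain \<tau> where \<tau>: "bij \<tau>" "\<tau> t = t'" "\<And>k u v. E k u v \<Longrightarrow> E (\<sigma> k) (\<tau> u) (\<tau> v)"
    using ex_tree_automorphism[OF \<sigma>] by blast
  obtain \<phi> where \<phi>: "field_hom \<phi>" "\<And>j. \<phi> (x t j) = x t' (\<sigma> j)"
    using field_hom_extending[OF free_generating algebraically_independent_reindex[OF independent \<sigma>]]
    by metis
  have invariant: "signed_perm \<sigma> \<epsilon> (B s) (B (\<tau> s)) \<and> (\<forall>j. \<phi> (x s j) = x (\<tau> s) (\<sigma> j))" for s
  proof (induction s rule: tree_induct[of _ t])
    case root
    then show ?case using assms \<phi> \<tau> by simp
  next
    case (step k u v)
    then show ?case
      using mutate_matrix_signed[of \<sigma> \<epsilon> "B u" "B (\<tau> u)" k]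
        mutate_cluster_field_hom[OF \<phi>(1), of \<sigma> \<epsilon> "S u" "S (\<tau> u)" k]
      by (simp add: seed_mutate[OF step(2)] seed_mutate[OF \<tau>(3)[OF step(2)]] mutate_def)
  qed
  \<comment> \<open>Both \<sigma> and \<tau> are onto, so every cluster variable is hit; hence
    \<open>A\<close> is mapped onto itself.\<close>
  have "\<phi> ` (\<Union>s. range (x s)) = (\<Union>s. range (x s))"
  proof (intro equalityI subsetI)
    fix a assume "a \<in> (\<Union>s. range (x s))"
    then obtain s j where "a = x s j" by blast
    then have "a = \<phi> (x (inv_into UNIV \<tau> s) (inv_into UNIV \<sigma> j))"
      using \<sigma> \<tau>(1) by (simp add: invariant bij_is_surj surj_f_inv_f)
    then show "a \<in> \<phi> ` (\<Union>s. range (x s))" by blast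
  qed (use invariant in auto)
  then have image: "\<phi> ` A = A"
    unfolding cluster_algebra_def by (simp add: field_hom_image_generated_subring[OF \<phi>(1)])
  define f where "f = restrict \<phi> A"
  have "bij_betw f A A"
    using image inj_on_subset[OF field_homD(10)[OF \<phi>(1)] subset_UNIV]
    unfolding bij_betw_def f_def by simp
  then have "f \<in> ring_automorphisms A"
    using field_homD(1-3)[OF \<phi>(1)] unfolding ring_automorphisms_def Bij_def
    by (auto simp: f_def cluster_algebra_def generated_subring_closed)
  then have "relabels f \<tau> \<sigma> \<epsilon>"
    using \<tau> invariant by (simp add: relabels_def f_def cluster_in_algebra)
  then show ?thesis using that \<tau>(2) by blast
qed

text \<open>Apply \<open>f\<close> to the exchange relation at \<open>t\<close> in direction
  \<open>k\<close> and compare with the one at \<open>t'\<close> in direction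
  \<open>\<sigma> k\<close>: the products agree, so the binomials do, and the columns match up to
  sign. Indecomposability makes the signs uniform.\<close>

lemma cluster_automorphismD:
  assumes f: "f \<in> ring_automorphisms A" and \<sigma>: "bij \<sigma>"
    and cluster: "\<And>j. f (x t j) = x t' (\<sigma> j)"
    and mutated: "\<And>k j. f (mutate_cluster k (S t) j) = mutate_cluster (\<sigma> k) (S t') (\<sigma> j)"
  obtains \<epsilon> where "signed_perm \<sigma> \<epsilon> (B t) (B t')"
proof -
  have "\<exists>\<epsilon>\<in>{1, -1}. \<forall>j. B t' $ \<sigma> j $ \<sigma> k = \<epsilon> * B t $ j $ k" for k
  proof (rule exchange_binomial_inject)
    show "algebraically_independent (\<lambda>j. x t' (\<sigma> j))"
      by (rule algebraically_independent_reindex[OF independent \<sigma>])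
    obtain u where u: "E k t u" using edge_neighbour by blast
    obtain u' where u': "E (\<sigma> k) t' u'" using edge_neighbour by blast
    have "exchange_binomial (\<lambda>j. x t' (\<sigma> j)) (\<lambda>j. B t $ j $ k) = f (x t k) * f (x u k)"
      using automorphism_exchange_relation[OF f u] by (simp add: cluster)
    also have "\<dots> = x t' (\<sigma> k) * x u' (\<sigma> k)"
      by (simp add: cluster mutated cluster_mutate[OF u] cluster_mutate[OF u'])
    also have "\<dots> = exchange_binomial (x t') (\<lambda>j. B t' $ j $ \<sigma> k)"
      by (rule exchange_relation[OF u'])
    finally show "exchange_binomial (\<lambda>j. x t' (\<sigma> j)) (\<lambda>j. B t' $ \<sigma> j $ \<sigma> k) =
        exchange_binomial (\<lambda>j. x t' (\<sigma> j)) (\<lambda>j. B t $ j $ k)"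
      using exchange_binomial_reindex[OF \<sigma>, of "x t'" "\<lambda>j. B t' $ j $ \<sigma> k"] by simp
  qed
  from uniform_column_sign[OF skew skew indecomposable \<sigma> this] show ?thesis
    using that by blast
qed

text \<open>One matched pair of seeds gives a signed permutation, hence a symmetry with the same
  values on a cluster, which must be \<open>f\<close>. Conversely, a mutated cluster is the cluster
  of a neighbour, and symmetries respect edges.\<close>

lemma cluster_automorphisms_iff: "f \<in> cluster_automorphisms S \<longleftrightarrow> (\<exists>\<tau>. symmetry f \<tau>)"
proof
  assume "f \<in> cluster_automorphisms S"
  then obtain t t' \<sigma> where f: "f \<in> ring_automorphisms A" and \<sigma>: "bij \<sigma>"
    and "permute_cluster \<sigma> (f \<circ> x t) = x t'"
    and "\<forall>k. permute_cluster \<sigma> (f \<circ> mutate_cluster k (S t)) = mutate_cluster (\<sigma> k) (S t')"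
    unfolding cluster_automorphisms_def by blast
  then have cluster: "\<And>j. f (x t j) = x t' (\<sigma> j)"
    and mutated: "\<And>k j. f (mutate_cluster k (S t) j) = mutate_cluster (\<sigma> k) (S t') (\<sigma> j)"
    by (simp_all add: permute_cluster_eq_iff)
  obtain \<epsilon> where "signed_perm \<sigma> \<epsilon> (B t) (B t')"
    using cluster_automorphismD[OF f \<sigma> cluster mutated] .
  then obtain g \<tau> where g: "relabels g \<tau> \<sigma> \<epsilon>" "\<tau> t = t'"
    by (rule ex_relabels)
  have "f = g"
    by (rule automorphism_determined[OF f]) (use g cluster in \<open>auto simp: relabels_def\<close>)
  then show "\<exists>\<tau>. symmetry f \<tau>" using g by (auto simp: symmetry_def)
next
  assume "\<exists>\<tau>. symmetry f \<tau>"
  then obtain \<tau> \<sigma> \<epsilon> where f: "relabels f \<tau> \<sigma> \<epsilon>" by (auto simp: symmetry_def)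
  then have \<sigma>: "bij \<sigma>" by (auto simp: relabels_def signed_perm_def)
  have mutated: "f (mutate_cluster k (S t) j) = mutate_cluster (\<sigma> k) (S (\<tau> t)) (\<sigma> j)" for k j t
  proof -
    obtain u where u: "E k t u" using edge_neighbour by blast
    then have "E (\<sigma> k) (\<tau> t) (\<tau> u)" using f by (simp add: relabels_def)
    then show ?thesis
      using f by (simp add: cluster_mutate[symmetric, OF u] cluster_mutate[symmetric] relabels_def)
  qed
  have "\<exists>t t' \<sigma>. bij \<sigma> \<and> permute_cluster \<sigma> (f \<circ> x t) = x t' \<and>
      (\<forall>k. permute_cluster \<sigma> (f \<circ> mutate_cluster k (S t)) = mutate_cluster (\<sigma> k) (S t'))"
    using f \<sigma> mutated
    \<comment> \<open>A symmetry satisfies the condition at every vertex; \<open>undefined\<close>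
      just picks one.\<close>
    by (intro exI[of _ undefined] exI[of _ "\<tau> undefined"] exI[of _ \<sigma>]) (simp add: permute_cluster_eq_iff relabels_def)
  then show "f \<in> cluster_automorphisms S"
    using f by (simp add: cluster_automorphisms_def relabels_def)
qed

text \<open>The description has a unique solution because the values on one cluster determine an
  automorphism.\<close>

lemma quad_automorphism_eqI:
  assumes "relabels f \<tau> \<sigma> \<epsilon>" "\<tau> t = t'"
  shows "quad_automorphism S t t' \<sigma> \<epsilon>' = f"
  unfolding quad_automorphism_def
proof (rule the_equality)
  have \<sigma>: "bij \<sigma>" using assms by (auto simp: relabels_def signed_perm_def)
  show "f \<in> cluster_automorphisms S \<and> permute_cluster \<sigma> (f \<circ> x t) = x t'"
    using assms \<sigma> by (auto simp: cluster_automorphisms_iff symmetry_def permute_cluster_eq_iff relabels_def)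
  fix g assume "g \<in> cluster_automorphisms S \<and> permute_cluster \<sigma> (g \<circ> x t) = x t'"
  then have "g \<in> ring_automorphisms A" "\<And>j. g (x t j) = x t' (\<sigma> j)"
    using \<sigma> by (auto simp: cluster_automorphisms_def permute_cluster_eq_iff)
  then show "g = f"
    using assms by (intro automorphism_determined[of g f t]) (auto simp: relabels_def)
qed

lemma symmetry_quad_automorphism:
  assumes "signed_perm \<sigma> \<epsilon> (B t) (B t')"
  obtains \<tau> where "symmetry (quad_automorphism S t t' \<sigma> \<epsilon>) \<tau>" "\<tau> t = t'"
  using ex_relabels[OF assms] quad_automorphism_eqI unfolding symmetry_def by metis

subsection \<open>The group of symmetries\<close>

lemma symmetry_in_ring_automorphisms: "symmetry f \<tau> \<Longrightarrow> f \<in> ring_automorphisms A"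
  by (auto simp: symmetry_def relabels_def)

lemma symmetry_bij: "symmetry f \<tau> \<Longrightarrow> bij \<tau>"
  by (auto simp: symmetry_def relabels_def)

lemma symmetry_tree_path:
  assumes "symmetry f \<tau>" shows "tree_path E (\<tau> u) (\<tau> v) = map \<tau> (tree_path E u v)"
  by (rule tree_path_map) (use assms in \<open>auto simp: symmetry_def relabels_def bij_is_inj\<close>)

lemma symmetry_id: "symmetry (\<lambda>a\<in>A. a) id"
proof -
  have "signed_perm id 1 (B s) (B s)" for s
    by (auto simp: signed_perm_iff)
  moreover have "(\<lambda>a\<in>A. a) \<in> ring_automorphisms A"
    by (auto simp: ring_automorphisms_def id_Bij cluster_algebra_def generated_subring_closed)
  ultimately have "relabels (\<lambda>a\<in>A. a) id id 1"
    by (auto simp: relabels_def cluster_in_algebra)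
  then show ?thesis by (auto simp: symmetry_def)
qed

lemma symmetry_compose:
  assumes "symmetry f \<tau>" "symmetry g \<tau>'"
  shows "symmetry (compose A f g) (\<tau> \<circ> \<tau>')"
proof -
  obtain \<sigma> \<epsilon> where f: "relabels f \<tau> \<sigma> \<epsilon>" using assms by (auto simp: symmetry_def)
  obtain \<sigma>' \<epsilon>' where g: "relabels g \<tau>' \<sigma>' \<epsilon>'" using assms by (auto simp: symmetry_def)
  have "\<epsilon> * \<epsilon>' \<in> {1, -1}" "bij (\<sigma> \<circ> \<sigma>')" "bij (\<tau> \<circ> \<tau>')"
    using f g by (auto simp: relabels_def signed_perm_iff bij_comp)
  moreover have "compose A f g \<in> ring_automorphisms A"
  proof -
    have maps: "\<And>a. a \<in> A \<Longrightarrow> g a \<in> A"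
      using g by (auto simp: relabels_def ring_automorphisms_def Bij_def bij_betw_def)
    show ?thesis
      using f g maps
      by (auto simp: relabels_def ring_automorphisms_def compose_Bij compose_eq
          cluster_algebra_def generated_subring_closed)
  qed
  ultimately have "relabels (compose A f g) (\<tau> \<circ> \<tau>') (\<sigma> \<circ> \<sigma>') (\<epsilon> * \<epsilon>')"
    using f g by (auto simp: relabels_def signed_perm_iff compose_eq cluster_in_algebra)
  then show ?thesis by (auto simp: symmetry_def)
qed

text \<open>The candidate \<open>g\<close> is built from the inverse permutation at one arbitrary
  vertex and then recognized: its tree map inverts \<tau> because label-preserving maps agreeing at
  a vertex coincide, and \<open>f\<close> after \<open>g\<close> is the identity because one cluster
  determines an automorphism.\<close>

lemma symmetry_inv:
  assumes "symmetry f \<tau>"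
  shows "symmetry (\<lambda>a\<in>A. inv_into A f a) (inv_into UNIV \<tau>)"
proof -
  obtain \<sigma> \<epsilon> where f: "relabels f \<tau> \<sigma> \<epsilon>" using assms by (auto simp: symmetry_def)
  have \<epsilon>: "\<epsilon> \<in> {1, -1}" and \<sigma>: "bij \<sigma>" and \<tau>: "bij \<tau>"
    using f by (auto simp: relabels_def signed_perm_iff)
  define t :: 't where "t = undefined"
  have \<tau>_inv: "\<tau> (inv_into UNIV \<tau> s) = s" for s
    using \<tau> by (simp add: bij_is_surj surj_f_inv_f)
  have \<sigma>_inv: "\<sigma> (inv_into UNIV \<sigma> j) = j" for j
    using \<sigma> by (simp add: bij_is_surj surj_f_inv_f)
  have "signed_perm (inv_into UNIV \<sigma>) \<epsilon> (B t) (B (inv_into UNIV \<tau> t))"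
  proof -
    have "signed_perm \<sigma> \<epsilon> (B (inv_into UNIV \<tau> t)) (B t)"
      using f \<tau>_inv by (metis relabels_def)
    then have *: "B t $ \<sigma> i $ \<sigma> j = \<epsilon> * B (inv_into UNIV \<tau> t) $ i $ j" for i j
      by (simp add: signed_perm_iff)
    have "B (inv_into UNIV \<tau> t) $ inv_into UNIV \<sigma> i $ inv_into UNIV \<sigma> j = \<epsilon> * B t $ i $ j" for i j
      using *[of "inv_into UNIV \<sigma> i" "inv_into UNIV \<sigma> j"] \<epsilon> by (auto simp: \<sigma>_inv)
    then show ?thesis using \<epsilon> \<sigma> by (simp add: signed_perm_iff bij_imp_bij_inv)
  qed
  then obtain g \<tau>' where g: "relabels g \<tau>' (inv_into UNIV \<sigma>) \<epsilon>" "\<tau>' t = inv_into UNIV \<tau> t"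
    by (rule ex_relabels)
  have "\<tau> (\<tau>' u) = id u" for u
  proof (rule label_preserving_unique[of id _ id t])
    show "E (id k) (\<tau> (\<tau>' u)) (\<tau> (\<tau>' v))" if "E k u v" for k u v
      using f g that \<sigma>_inv by (metis id_apply relabels_def)
  qed (simp_all add: g \<tau>_inv)
  then have \<tau>': "\<tau>' = inv_into UNIV \<tau>"
    using bij_inv_eq_iff[OF \<tau>] by (metis ext id_apply)
  have fA: "bij_betw f A A" using f by (simp add: relabels_def ring_automorphisms_def Bij_def)
  have gA: "g \<in> extensional A" "\<And>a. a \<in> A \<Longrightarrow> g a \<in> A"
    using g by (auto simp: relabels_def ring_automorphisms_def Bij_def bij_betw_def)
  have "compose A f g = (\<lambda>a\<in>A. a)"
  proof (rule automorphism_determined[of _ _ t])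
    show "compose A f g \<in> ring_automorphisms A"
      using symmetry_compose[of f \<tau> g \<tau>'] f g(1) symmetry_in_ring_automorphisms
      by (auto simp: symmetry_def)
    show "(\<lambda>a\<in>A. a) \<in> ring_automorphisms A"
      using symmetry_id by (rule symmetry_in_ring_automorphisms)
    show "compose A f g (x t j) = (\<lambda>a\<in>A. a) (x t j)" for j
      using f g \<tau>_inv \<sigma>_inv by (simp add: compose_eq cluster_in_algebra relabels_def)
  qed
  then have "f (g a) = a" if "a \<in> A" for a
    using that by (metis compose_eq restrict_apply')
  then have "g = (\<lambda>a\<in>A. inv_into A f a)"
    using gA fA
    by (intro extensionalityI[of _ A])
       (auto simp: bij_betw_def intro!: inv_into_f_eq[symmetric])
  then show ?thesis using g \<tau>' by (auto simp: symmetry_def)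
qed

section \<open>The group of cluster automorphisms\<close>

lemma mult_Aut_cluster:
  "f \<in> Bij A \<Longrightarrow> g \<in> Bij A \<Longrightarrow> f \<otimes>\<^bsub>Aut_cluster S\<^esub> g = compose A f g"
  by (simp add: Aut_cluster_def BijGroup_def)

lemma symmetry_Bij: "symmetry f \<tau> \<Longrightarrow> f \<in> Bij A"
  using symmetry_in_ring_automorphisms by (auto simp: ring_automorphisms_def)

lemma subgroup_cluster_automorphisms: "subgroup (cluster_automorphisms S) (BijGroup A)"
proof (rule group.subgroupI[OF group_BijGroup])
  show "cluster_automorphisms S \<subseteq> carrier (BijGroup A)"
    by (auto simp: cluster_automorphisms_def ring_automorphisms_def BijGroup_def)
  show "cluster_automorphisms S \<noteq> {}"
    using symmetry_id cluster_automorphisms_iff by blast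
  fix f assume "f \<in> cluster_automorphisms S"
  then obtain \<tau> where f: "symmetry f \<tau>" by (auto simp: cluster_automorphisms_iff)
  show "inv\<^bsub>BijGroup A\<^esub> f \<in> cluster_automorphisms S"
    using symmetry_inv[OF f] by (auto simp: inv_BijGroup symmetry_Bij[OF f] cluster_automorphisms_iff)
  fix g assume "g \<in> cluster_automorphisms S"
  then obtain \<tau>' where g: "symmetry g \<tau>'" by (auto simp: cluster_automorphisms_iff)
  show "f \<otimes>\<^bsub>BijGroup A\<^esub> g \<in> cluster_automorphisms S"
    using symmetry_compose[OF f g] symmetry_Bij[OF f] symmetry_Bij[OF g]
    by (auto simp: BijGroup_def cluster_automorphisms_iff)
qed

lemma group_Aut_cluster: "group (Aut_cluster S)"
  unfolding Aut_cluster_def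
  by (rule subgroup.subgroup_is_group[OF subgroup_cluster_automorphisms group_BijGroup])

lemma carrier_Aut_cluster: "carrier (Aut_cluster S) = cluster_automorphisms S"
  by (simp add: Aut_cluster_def)

lemma symmetry_mult:
  "symmetry f \<tau> \<Longrightarrow> symmetry g \<tau>' \<Longrightarrow> symmetry (f \<otimes>\<^bsub>Aut_cluster S\<^esub> g) (\<tau> \<circ> \<tau>')"
  by (simp add: mult_Aut_cluster symmetry_Bij symmetry_compose)

lemma symmetry_m_inv:
  assumes f: "symmetry f \<tau>" shows "symmetry (inv\<^bsub>Aut_cluster S\<^esub> f) (inv_into UNIV \<tau>)"
proof -
  have "f \<in> cluster_automorphisms S" using f cluster_automorphisms_iff by blast
  then have "inv\<^bsub>Aut_cluster S\<^esub> f = inv\<^bsub>BijGroup A\<^esub> f"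
    unfolding Aut_cluster_def
    by (rule group.m_inv_consistent[OF group_BijGroup subgroup_cluster_automorphisms])
  then show ?thesis
    by (simp add: inv_BijGroup symmetry_Bij[OF f] symmetry_inv[OF f])
qed

section \<open>Orbits of vertices under symmetries\<close>

definition orbit :: "'t \<Rightarrow> 't set" where
  "orbit s = {\<tau> s | f \<tau>. symmetry f \<tau>}"

lemma orbitI: "symmetry f \<tau> \<Longrightarrow> \<tau> s \<in> orbit s"
  unfolding orbit_def by blast

lemma orbitE:
  assumes "v \<in> orbit s" obtains f \<tau> where "symmetry f \<tau>" "v = \<tau> s"
  using assms unfolding orbit_def by blast

lemma orbit_refl: "s \<in> orbit s"
  using orbitI[OF symmetry_id] by simp

lemma symmetry_in_orbit_iff:
  assumes f: "symmetry f \<tau>" shows "\<tau> v \<in> orbit s \<longleftrightarrow> v \<in> orbit s"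
proof
  assume "v \<in> orbit s"
  then obtain g \<tau>' where g: "symmetry g \<tau>'" "v = \<tau>' s" by (rule orbitE)
  then show "\<tau> v \<in> orbit s"
    using orbitI[OF symmetry_compose[OF f g(1)], of s] by simp
next
  assume "\<tau> v \<in> orbit s"
  then obtain g \<tau>' where g: "symmetry g \<tau>'" "\<tau> v = \<tau>' s" by (rule orbitE)
  then have "inv_into UNIV \<tau> (\<tau>' s) = v"
    using symmetry_bij[OF f] by (metis bij_inv_eq_iff)
  then show "v \<in> orbit s"
    using orbitI[OF symmetry_compose[OF symmetry_inv[OF f] g(1)], of s] by simp
qed

lemma orbit_sym:
  assumes "v \<in> orbit s" shows "s \<in> orbit v"
proof -
  obtain f \<tau> where "symmetry f \<tau>" "v = \<tau> s" using assms by (rule orbitE)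
  then show ?thesis using symmetry_in_orbit_iff[of f \<tau> s v] orbit_refl by simp
qed

lemma orbits_meet:
  assumes "v \<in> orbit s" "v \<in> orbit s'" shows "s' \<in> orbit s"
proof -
  obtain f \<tau> where "symmetry f \<tau>" "v = \<tau> s'" using assms(2) by (rule orbitE)
  then show ?thesis using symmetry_in_orbit_iff[of f \<tau> s' s] assms(1) by simp
qed

text \<open>A signed permutation between two exchange matrices is realized by a symmetry, and every
  symmetry matches exchange matrices. Weights thereby become counts of orbit members.\<close>

lemma matrix_sim_pm_iff: "matrix_sim_pm (B v) (B s) \<longleftrightarrow> v \<in> orbit s"
proof
  assume "matrix_sim_pm (B v) (B s)"
  then obtain \<sigma> \<epsilon> where "signed_perm \<sigma> \<epsilon> (B v) (B s)"
    by (auto simp: matrix_sim_pm_iff_signed_perm)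
  then obtain f \<tau> where "relabels f \<tau> \<sigma> \<epsilon>" "\<tau> v = s" by (rule ex_relabels)
  then have "s \<in> orbit v" by (auto simp: orbit_def symmetry_def)
  then show "v \<in> orbit s" by (rule orbit_sym)
next
  assume "v \<in> orbit s"
  then have "s \<in> orbit v" by (rule orbit_sym)
  then obtain f \<tau> where "symmetry f \<tau>" "s = \<tau> v" by (rule orbitE)
  then show "matrix_sim_pm (B v) (B s)"
    unfolding matrix_sim_pm_iff_signed_perm symmetry_def relabels_def by blast
qed

lemma weight_eq: "weight E S s t t' = card (set (tree_path E t t') \<inter> orbit s)"
  by (simp add: weight_def matrix_sim_pm_iff Int_def)

end

subsection \<open>Generators\<close>

locale pattern_with_choice = indecomposable_pattern E S
  for E :: "'n::finite \<Rightarrow> 't \<Rightarrow> 't \<Rightarrow> bool"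
    and S :: "'t \<Rightarrow> ('n, 'f::field_char_0) seed" +
  fixes t\<^sub>0 t\<^sub>d :: 't and perm :: "'t \<Rightarrow> 'n \<Rightarrow> 'n" and sign :: "'t \<Rightarrow> int"
  assumes not_sim: "\<not> matrix_sim_pm (B t\<^sub>d) (B t\<^sub>0)"
    and weight_root: "weight E S t\<^sub>0 t\<^sub>0 t\<^sub>d = 1"
    and weight_diamond: "weight E S t\<^sub>d t\<^sub>0 t\<^sub>d = 1"
    and choice: "matrix_sim_pm (B t) (B t\<^sub>0) \<Longrightarrow> signed_perm (perm t) (sign t) (B t\<^sub>0) (B t)"
begin

abbreviation f\<^sub>p :: "'t \<Rightarrow> 'f \<Rightarrow> 'f" where
  "f\<^sub>p \<equiv> path_automorphism S t\<^sub>0 perm sign"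

abbreviation generators :: "('f \<Rightarrow> 'f) set" where
  "generators \<equiv> G0 S t\<^sub>0 \<union> H1 E S f\<^sub>p t\<^sub>d t\<^sub>0 0 \<union> H1 E S f\<^sub>p t\<^sub>d t\<^sub>0 1 \<union> K1 E S f\<^sub>p t\<^sub>d t\<^sub>0"

abbreviation generated :: "('f \<Rightarrow> 'f) set" where
  "generated \<equiv> generate (Aut_cluster S) generators"

section \<open>Hypotheses and generating sets in terms of orbits\<close>

lemma orbits_disjoint: "v \<in> orbit t\<^sub>0 \<Longrightarrow> v \<notin> orbit t\<^sub>d"
  using orbits_meet[of v t\<^sub>0 t\<^sub>d] not_sim by (auto simp: matrix_sim_pm_iff)

text \<open>Each intersection has one element by the weight hypotheses and contains the
  corresponding endpoint.\<close>

lemma root_path_orbits: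
  "set (tree_path E t\<^sub>0 t\<^sub>d) \<inter> orbit t\<^sub>0 = {t\<^sub>0}" "set (tree_path E t\<^sub>0 t\<^sub>d) \<inter> orbit t\<^sub>d = {t\<^sub>d}"
proof -
  have "X = {v}" if "card X = 1" "v \<in> X" for X and v :: 't
    using that by (metis card_1_singletonE singletonD)
  then show "set (tree_path E t\<^sub>0 t\<^sub>d) \<inter> orbit t\<^sub>0 = {t\<^sub>0}" "set (tree_path E t\<^sub>0 t\<^sub>d) \<inter> orbit t\<^sub>d = {t\<^sub>d}"
    using weight_root weight_diamond endpoints_in_tree_path orbit_refl
    by (simp_all add: weight_eq)
qed

lemma symmetry_path_automorphism:
  assumes "t \<in> orbit t\<^sub>0"
  obtains \<tau> where "symmetry (f\<^sub>p t) \<tau>" "\<tau> t\<^sub>0 = t"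
  unfolding path_automorphism_def
  using assms by (metis symmetry_quad_automorphism choice matrix_sim_pm_iff)

lemma tree_path_in_P1_iff:
  "tree_path E t\<^sub>0 t \<in> P1 E S t\<^sub>d t\<^sub>0 m \<longleftrightarrow>
     t \<in> orbit t\<^sub>0 \<and> card (set (tree_path E t\<^sub>0 t) \<inter> orbit t\<^sub>0) = 2 \<and>
     card (set (tree_path E t\<^sub>0 t) \<inter> orbit t\<^sub>d) = m"
proof -
  have "tree_path E t\<^sub>0 t = tree_path E t\<^sub>0 t' \<longleftrightarrow> t = t'" for t'
    by (metis last_tree_path)
  then show ?thesis
    by (auto simp: P1_def weight_eq matrix_sim_pm_iff)
qed

lemma generators_in_carrier: "generators \<subseteq> carrier (Aut_cluster S)"
proof -
  have "f \<in> cluster_automorphisms S" if "f \<in> G0 S t\<^sub>0" for f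
    using that symmetry_quad_automorphism unfolding G0_def cluster_automorphisms_iff by blast
  moreover have "f\<^sub>p t \<in> cluster_automorphisms S" if "t \<in> orbit t\<^sub>0" for t
    using symmetry_path_automorphism[OF that] cluster_automorphisms_iff by blast
  ultimately show ?thesis
    by (auto simp: carrier_Aut_cluster H1_def K1_def tree_path_in_P1_iff)
qed

text \<open>A symmetry fixing \<open>t\<^sub>0\<close> is one of the quadruples collected in
  \<open>G0\<close>.\<close>

lemma stabilizer_generated:
  assumes "symmetry f \<tau>" "\<tau> t\<^sub>0 = t\<^sub>0" shows "f \<in> generated"
proof -
  obtain \<sigma> \<epsilon> where f: "relabels f \<tau> \<sigma> \<epsilon>" using assms by (auto simp: symmetry_def)
  then have "signed_perm \<sigma> \<epsilon> (B t\<^sub>0) (B t\<^sub>0)"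
    using assms(2) unfolding relabels_def by metis
  then have "f \<in> G0 S t\<^sub>0"
    using quad_automorphism_eqI[OF f assms(2), of \<epsilon>] unfolding G0_def by blast
  then show ?thesis by (intro generate.incl) blast
qed

text \<open>The two symmetries differ by one fixing \<open>t\<^sub>0\<close>, which is
  generated.\<close>

lemma generated_if_same_image:
  assumes f: "symmetry f \<tau>" and g: "symmetry g \<tau>'" and eq: "\<tau> t\<^sub>0 = \<tau>' t\<^sub>0" and "g \<in> generated"
  shows "f \<in> generated"
proof -
  interpret group "Aut_cluster S" by (rule group_Aut_cluster)
  let ?h = "inv\<^bsub>Aut_cluster S\<^esub> g \<otimes>\<^bsub>Aut_cluster S\<^esub> f"
  have "symmetry ?h (inv_into UNIV \<tau>' \<circ> \<tau>)"
    by (rule symmetry_mult[OF symmetry_m_inv[OF g] f])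
  moreover have "(inv_into UNIV \<tau>' \<circ> \<tau>) t\<^sub>0 = t\<^sub>0"
    using symmetry_bij[OF g] by (simp add: eq bij_is_inj)
  ultimately have "?h \<in> generated" by (rule stabilizer_generated)
  moreover have "f = g \<otimes>\<^bsub>Aut_cluster S\<^esub> ?h"
  proof -
    have "f \<in> carrier (Aut_cluster S)" "g \<in> carrier (Aut_cluster S)"
      using f g cluster_automorphisms_iff carrier_Aut_cluster by blast+
    then show ?thesis by (simp add: m_assoc[symmetric])
  qed
  ultimately show ?thesis using generate.eng[OF assms(4)] by metis
qed

section \<open>Copies of the root reached by generated symmetries\<close>

definition reached :: "'t set" where
  "reached = {\<tau> t\<^sub>0 | f \<tau>. symmetry f \<tau> \<and> f \<in> generated}"

lemma reachedI: "symmetry f \<tau> \<Longrightarrow> f \<in> generated \<Longrightarrow> \<tau> t\<^sub>0 \<in> reached"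
  unfolding reached_def by blast

text \<open>Whether a symmetry is generated is decided by the image of \<open>t\<^sub>0\<close>, so
  the theorem becomes a statement about vertices: every copy of \<open>t\<^sub>0\<close> is
  reached.\<close>

lemma generated_if_reached: "symmetry f \<tau> \<Longrightarrow> \<tau> t\<^sub>0 \<in> reached \<Longrightarrow> f \<in> generated"
  using generated_if_same_image by (auto simp: reached_def)

lemma root_reached: "t\<^sub>0 \<in> reached"
  using reachedI[OF symmetry_id stabilizer_generated[OF symmetry_id]] by simp

text \<open>Products of generated symmetries are generated; this lets a step found at the root be
  translated by \<tau>.\<close>

lemma reached_image:
  assumes f: "symmetry f \<tau>" "\<tau> t\<^sub>0 \<in> reached" and v: "v \<in> reached"
  shows "\<tau> v \<in> reached"
proof -
  obtain g \<tau>' where g: "symmetry g \<tau>'" "v = \<tau>' t\<^sub>0" "g \<in> generated"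
    using v by (auto simp: reached_def)
  have "f \<otimes>\<^bsub>Aut_cluster S\<^esub> g \<in> generated"
    by (rule generate.eng[OF generated_if_reached[OF f] g(3)])
  then show ?thesis
    using reachedI[OF symmetry_mult[OF f(1) g(1)]] g(2) by simp
qed

text \<open>At most two copies of \<open>t\<^sub>d\<close> lie on the path, namely
  \<open>t\<^sub>d\<close> and \<open>w\<close>, and two of them force \<open>t\<^sub>d\<close> to
  be present. The path therefore belongs to \<open>H1\<close> with index 0 or 1, or to
  \<open>K1\<close>.\<close>

lemma reached_by_generator:
  assumes v: "v \<in> orbit t\<^sub>0"
    and root: "set (tree_path E t\<^sub>0 v) \<inter> orbit t\<^sub>0 \<subseteq> {t\<^sub>0, v}"
    and diamond: "set (tree_path E t\<^sub>0 v) \<inter> orbit t\<^sub>d \<subseteq> {t\<^sub>d, w}"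
  shows "v \<in> reached"
proof (cases "v = t\<^sub>0")
  \<comment> \<open>The path then has a single vertex, hence weight 1 instead of 2; the identity
    reaches \<open>t\<^sub>0\<close>.\<close>
  case True
  then show ?thesis by (simp add: root_reached)
next
  case False
  let ?D = "set (tree_path E t\<^sub>0 v) \<inter> orbit t\<^sub>d"
  have "set (tree_path E t\<^sub>0 v) \<inter> orbit t\<^sub>0 = {t\<^sub>0, v}"
    using root endpoints_in_tree_path v orbit_refl by blast
  then have P1: "tree_path E t\<^sub>0 v \<in> P1 E S t\<^sub>d t\<^sub>0 (card ?D)"
    using False v by (simp add: tree_path_in_P1_iff)
  have "card ?D = 0 \<or> card ?D = 1 \<or> card ?D = 2 \<and> t\<^sub>d \<in> set (tree_path E t\<^sub>0 v)"
  proof (cases "t\<^sub>d \<in> set (tree_path E t\<^sub>0 v)")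
    case True
    have "card ?D \<le> card {t\<^sub>d, w}" by (rule card_mono[OF _ diamond]) simp
    also have "\<dots> \<le> 2" by (simp add: card_insert_if)
    finally show ?thesis using True by linarith
  next
    case False
    then have "?D \<subseteq> {w}" using diamond by blast
    then have "card ?D \<le> card {w}" by (intro card_mono) simp_all
    then show ?thesis by (auto simp: le_Suc_eq)
  qed
  then have "f\<^sub>p v \<in> generators"
    using P1 unfolding H1_def K1_def by fastforce
  then have "f\<^sub>p v \<in> generated" by (rule generate.incl)
  then show ?thesis
    using symmetry_path_automorphism[OF v] unfolding reached_def by blast
qed

text \<open>
  An anchor of a vertex \<open>s\<close> lying in one of the two orbits is \<open>s\<close> itself or, if \<open>s\<close> is a copy of
  \<open>t\<^sub>d\<close>, the copy of \<open>t\<^sub>0\<close> obtained by transporting the path from \<open>t\<^sub>d\<close> to \<open>t\<^sub>0\<close>.  The detours to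
  the anchors cut an arbitrary path between copies of \<open>t\<^sub>0\<close> into translates of generating paths.
\<close>

definition anchor :: "'t \<Rightarrow> 't \<Rightarrow> bool" where
  "anchor s u \<longleftrightarrow> (\<exists>f \<tau>. symmetry f \<tau> \<and> u = \<tau> t\<^sub>0 \<and> (s = \<tau> t\<^sub>0 \<or> s = \<tau> t\<^sub>d))"

lemma ex_anchor_iff: "(\<exists>u. anchor s u) \<longleftrightarrow> s \<in> orbit t\<^sub>0 \<union> orbit t\<^sub>d"
  by (auto simp: anchor_def orbit_def)

lemma anchor_self: "s \<in> orbit t\<^sub>0 \<Longrightarrow> anchor s s"
  by (auto simp: anchor_def orbit_def)

text \<open>The alternative \<open>s = \<tau> t\<^sub>d\<close> would put \<open>s\<close> into both
  orbits, which are disjoint.\<close>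

lemma anchor_root_unique: "anchor s u \<Longrightarrow> s \<in> orbit t\<^sub>0 \<Longrightarrow> u = s"
  using orbits_disjoint orbit_refl symmetry_in_orbit_iff unfolding anchor_def by blast

text \<open>The path is trivial or a translate of the path from \<open>t\<^sub>d\<close> to
  \<open>t\<^sub>0\<close>, which meets each orbit only in the corresponding endpoint.\<close>

lemma anchor_path_orbits:
  assumes "anchor s u"
  shows "set (tree_path E s u) \<inter> orbit t\<^sub>0 \<subseteq> {u}" "set (tree_path E s u) \<inter> orbit t\<^sub>d \<subseteq> {s}"
proof -
  obtain f \<tau> where f: "symmetry f \<tau>" and u: "u = \<tau> t\<^sub>0" and s: "s = \<tau> t\<^sub>0 \<or> s = \<tau> t\<^sub>d"
    using assms by (auto simp: anchor_def)
  have image: "set (tree_path E (\<tau> t\<^sub>d) (\<tau> t\<^sub>0)) = \<tau> ` set (tree_path E t\<^sub>0 t\<^sub>d)"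
    by (simp add: symmetry_tree_path[OF f] tree_path_commute[of t\<^sub>d t\<^sub>0])
  have orbits: "z = t\<^sub>0" if "z \<in> set (tree_path E t\<^sub>0 t\<^sub>d)" "z \<in> orbit t\<^sub>0" for z
    using root_path_orbits that by blast
  have orbits': "z = t\<^sub>d" if "z \<in> set (tree_path E t\<^sub>0 t\<^sub>d)" "z \<in> orbit t\<^sub>d" for z
    using root_path_orbits that by blast
  have "set (tree_path E (\<tau> t\<^sub>d) (\<tau> t\<^sub>0)) \<inter> orbit t\<^sub>0 \<subseteq> {\<tau> t\<^sub>0}"
    "set (tree_path E (\<tau> t\<^sub>d) (\<tau> t\<^sub>0)) \<inter> orbit t\<^sub>d \<subseteq> {\<tau> t\<^sub>d}"
    unfolding image using orbits orbits' symmetry_in_orbit_iff[OF f] by blast+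
  then show "set (tree_path E s u) \<inter> orbit t\<^sub>0 \<subseteq> {u}" "set (tree_path E s u) \<inter> orbit t\<^sub>d \<subseteq> {s}"
    using s u by auto
qed

text \<open>The route from \<open>u'\<close> via \<open>s'\<close> and \<open>s\<close> to
  \<open>u\<close> covers the tree path between its ends. Its copies of \<open>t\<^sub>0\<close> are
  among \<open>u'\<close> and \<open>u\<close>, its copies of \<open>t\<^sub>d\<close> among
  \<open>s'\<close> and \<open>s\<close>. Pulled back by a symmetry carrying
  \<open>t\<^sub>0\<close> to \<open>u'\<close>, the tree path becomes one that
  \<open>reached_by_generator\<close> handles.\<close>

lemma anchor_reached_step:
  assumes u': "anchor s' u'" "u' \<in> reached" and u: "anchor s u"
    and path: "set (tree_path E s' s) \<inter> (orbit t\<^sub>0 \<union> orbit t\<^sub>d) \<subseteq> {s', s}"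
  shows "u \<in> reached"
proof -
  obtain f \<tau> where f: "symmetry f \<tau>" "u' = \<tau> t\<^sub>0" and s': "s' = \<tau> t\<^sub>0 \<or> s' = \<tau> t\<^sub>d"
    using u'(1) by (auto simp: anchor_def)
  define v where "v = inv_into UNIV \<tau> u"
  have \<tau>_v: "\<tau> v = u" and inj: "inj \<tau>"
    using symmetry_bij[OF f(1)] by (simp_all add: v_def bij_is_inj bij_is_surj surj_f_inv_f)
  have cover: "set (tree_path E u' u) \<subseteq>
      set (tree_path E s' u') \<union> set (tree_path E s' s) \<union> set (tree_path E s u)"
    using tree_path_subset_Un[of u' u s'] tree_path_subset_Un[of s' u s]
    by (auto simp: tree_path_commute[of u' s'])
  have translate: "y \<in> set (tree_path E t\<^sub>0 v) \<Longrightarrow> \<tau> y \<in> set (tree_path E u' u)" for y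
    by (simp add: symmetry_tree_path[OF f(1), of t\<^sub>0 v, unfolded \<tau>_v] f(2))
  have "v \<in> reached"
  proof (rule reached_by_generator)
    have "u \<in> orbit t\<^sub>0" using u by (auto simp: anchor_def orbit_def)
    then show "v \<in> orbit t\<^sub>0" using symmetry_in_orbit_iff[OF f(1), of v] \<tau>_v by simp
    show "set (tree_path E t\<^sub>0 v) \<inter> orbit t\<^sub>0 \<subseteq> {t\<^sub>0, v}"
    proof
      fix y assume y: "y \<in> set (tree_path E t\<^sub>0 v) \<inter> orbit t\<^sub>0"
      then have "\<tau> y \<in> set (tree_path E u' u)" "\<tau> y \<in> orbit t\<^sub>0"
        using translate symmetry_in_orbit_iff[OF f(1)] by auto
      then have "\<tau> y \<in> {u', u}"
        using cover anchor_path_orbits(1)[OF u'(1)] anchor_path_orbits(1)[OF u] path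
          anchor_root_unique[OF u'(1)] anchor_root_unique[OF u] by blast
      then show "y \<in> {t\<^sub>0, v}" using inj f(2) \<tau>_v by (auto simp: inj_eq)
    qed
    \<comment> \<open>The preimage of \<open>s\<close> takes the role of \<open>w\<close>; if
      \<open>s'\<close> is a copy of \<open>t\<^sub>d\<close>, its preimage is
      \<open>t\<^sub>d\<close> itself.\<close>
    show "set (tree_path E t\<^sub>0 v) \<inter> orbit t\<^sub>d \<subseteq> {t\<^sub>d, inv_into UNIV \<tau> s}"
    proof
      fix y assume y: "y \<in> set (tree_path E t\<^sub>0 v) \<inter> orbit t\<^sub>d"
      then have orb: "\<tau> y \<in> set (tree_path E u' u)" "\<tau> y \<in> orbit t\<^sub>d"
        using translate symmetry_in_orbit_iff[OF f(1)] by auto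
      then have "\<tau> y \<in> {s', s}"
        using cover anchor_path_orbits(2)[OF u'(1)] anchor_path_orbits(2)[OF u] path by blast
      \<comment> \<open>This rules out the case that \<open>s'\<close> is a copy of
        \<open>t\<^sub>0\<close> and equals \<open>\<tau> y\<close>.\<close>
      moreover have "\<tau> y \<noteq> \<tau> t\<^sub>0"
        using y orbits_disjoint[OF orbit_refl] inj by (auto simp: inj_eq)
      ultimately have "\<tau> y = \<tau> t\<^sub>d \<or> \<tau> y = s" using s' by blast
      then show "y \<in> {t\<^sub>d, inv_into UNIV \<tau> s}" using inj by (auto simp: inj_eq)
    qed
  qed
  then show ?thesis
    using reached_image[OF f(1)] u'(2) f(2) \<tau>_v by blast
qed

text \<open>Move through the tree and remember a vertex \<open>s\<close> of one of the two orbits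
  such that the path from \<open>s\<close> to the current position meets no other vertex of these
  orbits.\<close>

lemma orbit_reached:
  assumes "v \<in> orbit t\<^sub>0" shows "v \<in> reached"
proof -
  let ?M = "orbit t\<^sub>0 \<union> orbit t\<^sub>d"
  \<comment> \<open>All anchors are quantified over because a copy of \<open>t\<^sub>d\<close> may
    have several; at the next vertex of \<open>?M\<close>, any anchor of \<open>s\<close> can serve
    as the starting point.\<close>
  have "\<exists>s. s \<in> ?M \<and> (\<forall>u. anchor s u \<longrightarrow> u \<in> reached) \<and> set (tree_path E s p) \<inter> ?M \<subseteq> {s}" for p
  proof (induction p rule: tree_induct[of _ t\<^sub>0])
    case root
    have "u \<in> reached" if "anchor t\<^sub>0 u" for u
      using anchor_root_unique[OF that orbit_refl] root_reached by simp
    then show ?case using orbit_refl by (intro exI[of _ t\<^sub>0]) auto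
  next
    case (step k p q)
    then obtain s where s: "s \<in> ?M" "\<And>u. anchor s u \<Longrightarrow> u \<in> reached"
      "set (tree_path E s p) \<inter> ?M \<subseteq> {s}" by blast
    have path: "set (tree_path E s q) \<subseteq> insert q (set (tree_path E s p))"
      using tree_path_subset_Un[of s q p] endpoints_in_tree_path(2)[of p s]
      by (auto simp: tree_path_edge[OF step(2)])
    show ?case
    proof (cases "q \<in> ?M")
      case True
      obtain u' where u': "anchor s u'" using s(1) ex_anchor_iff by blast
      have "u \<in> reached" if "anchor q u" for u
        using anchor_reached_step[OF u' s(2)[OF u'] that] path s(3) by blast
      then show ?thesis using True by (intro exI[of _ q]) auto
    next
      case False
      then show ?thesis using s path by (intro exI[of _ s]) blast
    qed
  qed
  then obtain s where s: "\<And>u. anchor s u \<Longrightarrow> u \<in> reached" "set (tree_path E s v) \<inter> ?M \<subseteq> {s}"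
    by blast
  \<comment> \<open>The endpoint \<open>v\<close> is itself in \<open>?M\<close> and lies on the
    path from \<open>s\<close>, so it is the remembered vertex.\<close>
  have "v = s" using s(2) assms endpoints_in_tree_path(2)[of v s] by blast
  then show ?thesis using s(1) anchor_self[OF assms] by blast
qed

lemma generated_eq_carrier: "generated = carrier (Aut_cluster S)"
proof
  show "generated \<subseteq> carrier (Aut_cluster S)"
    by (rule group.generate_incl[OF group_Aut_cluster generators_in_carrier])
  show "carrier (Aut_cluster S) \<subseteq> generated"
  proof
    fix f assume "f \<in> carrier (Aut_cluster S)"
    then obtain \<tau> where f: "symmetry f \<tau>"
      by (auto simp: carrier_Aut_cluster cluster_automorphisms_iff)
    then have "\<tau> t\<^sub>0 \<in> orbit t\<^sub>0" by (auto simp: orbit_def)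
    then show "f \<in> generated" by (rule generated_if_reached[OF f orbit_reached])
  qed
qed

end

theorem proposition3p13:
  fixes E :: "'n::finite \<Rightarrow> 't \<Rightarrow> 't \<Rightarrow> bool"
    and S :: "'t \<Rightarrow> ('n, 'f::field_char_0) seed"
    and t\<^sub>0 t\<^sub>d :: 't
    and \<sigma> :: "'t \<Rightarrow> 'n \<Rightarrow> 'n"
    and \<epsilon> :: "'t \<Rightarrow> int"
  assumes "cluster_pattern E S"
    and "\<And>t. indecomposable (exchange_matrix (S t))"
    and "\<not> matrix_sim_pm (exchange_matrix (S t\<^sub>d)) (exchange_matrix (S t\<^sub>0))"
    and "weight E S t\<^sub>0 t\<^sub>0 t\<^sub>d = 1"
    and "weight E S t\<^sub>d t\<^sub>0 t\<^sub>d = 1"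
    and "\<And>t. matrix_sim_pm (exchange_matrix (S t)) (exchange_matrix (S t\<^sub>0)) \<Longrightarrow>
           signed_perm (\<sigma> t) (\<epsilon> t) (exchange_matrix (S t\<^sub>0)) (exchange_matrix (S t))"
  shows "generate (Aut_cluster S)
           (G0 S t\<^sub>0 \<union> H1 E S (path_automorphism S t\<^sub>0 \<sigma> \<epsilon>) t\<^sub>d t\<^sub>0 0
                 \<union> H1 E S (path_automorphism S t\<^sub>0 \<sigma> \<epsilon>) t\<^sub>d t\<^sub>0 1
                 \<union> K1 E S (path_automorphism S t\<^sub>0 \<sigma> \<epsilon>) t\<^sub>d t\<^sub>0)
         = carrier (Aut_cluster S)"
proof -
  interpret pattern_with_choice E S t\<^sub>0 t\<^sub>d \<sigma> \<epsilon>
    using assms by unfold_locales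
  show ?thesis by (rule generated_eq_carrier)
qed

end
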